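(* For every real $\alpha\in(0,\tfrac12)$ there is $\nu_1=\nu_1(\alpha)$ such that for every $\nu>\nu_1$, the random graph $G_{\mathrm{Po}}(n;\alpha,\nu)$ has a Hamilton cycle (and hence a near perfect matching) with probability $1-o(n^{-1/2})$ as $n\to\infty$.
   Context: KPKVB model: fix $\alpha>0$, $\nu>0$, an integer $n>\nu$, and $R=2\ln(n/\nu)$. $\mathcal D_R$ is the hyperbolic disk (curvature $-1$) of radius $R$ around the origin, with polar coordinates $(r,\theta)$, $r\in[0,R)$, $\theta\in(0,2\pi]$; $f_{\alpha,R}(r,\theta)=\frac{\alpha\sinh(\alpha r)}{2\pi(\cosh(\alpha R)-1)}$. Poissonised model $G_{\mathrm{Po}}(n;\alpha,\nu)$: the vertex set is a Poisson point process $\mathcal P$ on $\mathcal D_R$ with intensity measure $n f_{\alpha,R}(r,\theta)\,dr\,d\theta$, two distinct points adjacent iff their hyperbolic distance is at most $R$. A near perfect matching is a matching covering all but at most one vertex. *)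

theory Defs
  imports "HOL-Probability.Probability" "HOL-Library.Landau_Symbols"
begin

text \<open>KPKVB model. Points are given in polar coordinates (r, theta).\<close>

definition kpkvb_R :: "nat \<Rightarrow> real \<Rightarrow> real" where
  "kpkvb_R n \<nu> = 2 * ln (real n / \<nu>)"

definition polar_disk :: "real \<Rightarrow> (real \<times> real) set" where
  "polar_disk R = {0..<R} \<times> {0<..2*pi}"

definition f_dens :: "real \<Rightarrow> real \<Rightarrow> real \<times> real \<Rightarrow> real" where
  "f_dens \<alpha> R p = \<alpha> * sinh (\<alpha> * fst p) / (2 * pi * (cosh (\<alpha> * R) - 1))"

text \<open>Probability distribution of a single point (normalised intensity measure),
  w.r.t. Lebesgue measure dr dtheta.\<close>
definition point_dist :: "real \<Rightarrow> real \<Rightarrow> (real \<times> real) measure" where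
  "point_dist \<alpha> R = density lborel
     (\<lambda>p. ennreal (indicator (polar_disk R) p * f_dens \<alpha> R p))"

text \<open>Hyperbolic distance (curvature -1) between points in polar coordinates.\<close>
definition hyp_dist :: "real \<times> real \<Rightarrow> real \<times> real \<Rightarrow> real" where
  "hyp_dist p q = arcosh (cosh (fst p) * cosh (fst q)
      - sinh (fst p) * sinh (fst q) * cos (snd p - snd q))"

definition kpkvb_adj :: "real \<Rightarrow> real \<times> real \<Rightarrow> real \<times> real \<Rightarrow> bool" where
  "kpkvb_adj R p q \<longleftrightarrow> p \<noteq> q \<and> hyp_dist p q \<le> R"

definition has_hamilton_cycle :: "(nat \<Rightarrow> nat \<Rightarrow> bool) \<Rightarrow> nat \<Rightarrow> bool" where
  "has_hamilton_cycle adj k \<longleftrightarrow> 3 \<le> k \<and>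
     (\<exists>\<sigma>. bij_betw \<sigma> {0..<k} {0..<k} \<and>
        (\<forall>i<k. adj (\<sigma> i) (\<sigma> ((i + 1) mod k))))"

definition ham_prob_k :: "real \<Rightarrow> real \<Rightarrow> nat \<Rightarrow> real" where
  "ham_prob_k \<alpha> R k = measure (PiM {0..<k} (\<lambda>_. point_dist \<alpha> R))
     {x \<in> space (PiM {0..<k} (\<lambda>_. point_dist \<alpha> R)).
        has_hamilton_cycle (\<lambda>i j. kpkvb_adj R (x i) (x j)) k}"

text \<open>Poisson point process with finite intensity n f: Poisson(n) many i.i.d.
  points of density f. Probability that G_Po(n; alpha, nu) is Hamiltonian.\<close>
definition ham_prob_Po :: "nat \<Rightarrow> real \<Rightarrow> real \<Rightarrow> real" where
  "ham_prob_Po n \<alpha> \<nu> =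
     (\<Sum>k. exp (- real n) * real n ^ k / fact k * ham_prob_k \<alpha> (kpkvb_R n \<nu>) k)"

end

theory Submission
  imports Defs "HOL-Real_Asymp.Real_Asymp"
begin

text \<open>The disk is cut into sixteen sectors, each of which is decomposed dyadically into cells, arranged in
  a binary tree, such that a point of a cell is adjacent to every point in the subtree of that cell.
  Going from the boundary to the centre, the points of a cell link the paths that cover its two
  subtrees; a sector gets a single path with both ends near the centre unless its cells contain
  too few points, and all points near the centre are adjacent. The number of
  superfluous paths has an exponential moment below 2, since for \<open>\<alpha> < 1/2\<close> the expected number of
  points in a cell of width \<open>w\<close> is at least of order \<open>\<nu> * (w * n / \<nu>) powr (1 - 2 * \<alpha>)\<close>, hence large at
  every level once \<open>\<nu>\<close> is. So a sector fails with probability at most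
  \<open>4 * exp 2 * exp (- c * n powr (1 - 2 * \<alpha>))\<close>.\<close>

section \<open>Linking paths\<close>

text \<open>The model is a Poisson mixture of \<open>k\<close> independent points, and for fixed
  \<open>k\<close> the counts in disjoint cells are dependent. Independence is recovered
  algebraically: \<open>exp (- N)\<close> is multiplicative over disjoint cells, so a multilinear
  expression in such values is a combination of \<open>exp (- N B)\<close> for unions
  \<open>B\<close> of cells. For fixed \<open>k\<close> the mean of each term is a
  \<open>k\<close>-th power, and the Poisson sum of these powers is an exponential, which is
  multiplicative again. Hence the mean of the majorant is the majorant evaluated at averaged values.
  The excess itself is not multilinear because of its truncated subtraction, which is why it is
  never averaged directly. Linking cells are wider than \<open>exp (- R / 2)\<close>, which is
  \<nu>/n; so w n/\<nu> is at least 1 in all of them, and 1 - 2 \<alpha> > 0 makes the cells near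
  the boundary the critical ones. Their expected count is of order \<nu>, whatever n is.\<close>

definition covers :: "('a \<Rightarrow> 'a \<Rightarrow> bool) \<Rightarrow> 'a set \<Rightarrow> nat \<Rightarrow> bool" where
  "covers E V m \<longleftrightarrow> (\<exists>ps. length ps \<le> m \<and> distinct (concat ps) \<and> set (concat ps) = V \<and>
     (\<forall>p\<in>set ps. successively E p))"

lemma coversI:
  "length ps \<le> m \<Longrightarrow> distinct (concat ps) \<Longrightarrow> set (concat ps) = V \<Longrightarrow>
   (\<And>p. p \<in> set ps \<Longrightarrow> successively E p) \<Longrightarrow> covers E V m"
  unfolding covers_def by blast

lemma coversE:
  assumes "covers E V m"
  obtains ps where "length ps \<le> m" "distinct (concat ps)" "set (concat ps) = V"
    "\<And>p. p \<in> set ps \<Longrightarrow> successively E p"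
  using assms unfolding covers_def by blast

lemma covers_mono: "covers E V m \<Longrightarrow> m \<le> m' \<Longrightarrow> covers E V m'"
  unfolding covers_def using le_trans by blast

lemma covers_empty: "covers E {} m"
  by (rule coversI[of "[]"]) auto

lemma covers_disjoint_Un:
  assumes "covers E V m" "covers E W m'" "V \<inter> W = {}"
  shows "covers E (V \<union> W) (m + m')"
proof -
  obtain ps where ps: "length ps \<le> m" "distinct (concat ps)" "set (concat ps) = V"
    "\<And>p. p \<in> set ps \<Longrightarrow> successively E p"
    using coversE[OF assms(1)] by blast
  obtain qs where qs: "length qs \<le> m'" "distinct (concat qs)" "set (concat qs) = W"
    "\<And>p. p \<in> set qs \<Longrightarrow> successively E p"
    using coversE[OF assms(2)] by blast
  show ?thesis
  proof (rule coversI[of "ps @ qs"])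
    show "length (ps @ qs) \<le> m + m'" using ps(1) qs(1) by simp
    show "distinct (concat (ps @ qs))"
      unfolding concat_append distinct_append using ps(2,3) qs(2,3) assms(3) by blast
    show "set (concat (ps @ qs)) = V \<union> W"
      unfolding concat_append set_append using ps(3) qs(3) by blast
    show "successively E p" if "p \<in> set (ps @ qs)" for p
      using that ps(4) qs(4) by (metis Un_iff set_append)
  qed
qed

lemma successively_link:
  assumes "successively E p" "successively E q"
    and "\<And>u. u \<in> set p \<union> set q \<Longrightarrow> E u v \<and> E v u"
  shows "successively E (p @ v # q)"
proof -
  have "p = [] \<or> E (last p) v" using assms(3) last_in_set by blast
  moreover have "q = [] \<or> E v (hd q)" using assms(3) hd_in_set by blast
  ultimately show ?thesis
    using assms(1,2) by (simp add: successively_append_iff successively_Cons)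
qed

text \<open>A vertex adjacent to everything glues two paths into one; a single path is extended by
  it, and with no path it forms one alone. Hence the floor of 1.\<close>

lemma covers_insert:
  assumes "covers E V m" "v \<notin> V" and adj: "\<And>u. u \<in> V \<Longrightarrow> E u v \<and> E v u"
  shows "covers E (insert v V) (max 1 (m - 1))"
proof -
  obtain ps where ps: "length ps \<le> m" "distinct (concat ps)" "set (concat ps) = V"
    "\<And>p. p \<in> set ps \<Longrightarrow> successively E p"
    using coversE[OF assms(1)] by blast
  consider "ps = []" | p where "ps = [p]" | p q rs where "ps = p # q # rs"
    by (metis neq_Nil_conv)
  then show ?thesis
  proof cases
    case 1
    then show ?thesis using ps(3) by (intro coversI[of "[[v]]"]) auto
  next
    case 2
    have "successively E (p @ [v])"
      using 2 ps(3,4) adj by (intro successively_link) auto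
    then show ?thesis using 2 ps(2,3) assms(2) by (intro coversI[of "[p @ [v]]"]) auto
  next
    case 3
    have "successively E (p @ v # q)"
    proof (rule successively_link)
      show "E u v \<and> E v u" if "u \<in> set p \<union> set q" for u
        using that adj[of u] ps(3) unfolding 3 by simp blast
    qed (use ps(4) 3 in simp_all)
    moreover have "distinct (concat ((p @ v # q) # rs))"
      using ps(2,3) assms(2) unfolding 3 by auto
    moreover have "set (concat ((p @ v # q) # rs)) = insert v V"
      using ps(3) unfolding 3 by auto
    ultimately show ?thesis
      using 3 ps(1,4) by (intro coversI[of "(p @ v # q) # rs"]) auto
  qed
qed

lemma covers_Un_dominating:
  assumes "finite A" "covers E V m" "A \<inter> V = {}"
    and "\<And>a u. a \<in> A \<Longrightarrow> u \<in> A \<union> V \<Longrightarrow> E a u \<and> E u a"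
  shows "covers E (A \<union> V) (max 1 (m - card A))"
  using assms(1,3,4)
proof (induction A)
  case empty
  then show ?case using covers_mono[OF assms(2)] by simp
next
  case (insert a A)
  have "covers E (A \<union> V) (max 1 (m - card A))"
    by (rule insert.IH) (use insert.prems in auto)
  then have "covers E (insert a (A \<union> V)) (max 1 (max 1 (m - card A) - 1))"
    by (rule covers_insert) (use insert.prems insert.hyps in auto)
  moreover have "max 1 (max 1 (m - card A) - 1) \<le> max 1 (m - card (insert a A))"
    using insert.hyps by auto
  ultimately show ?case by (metis covers_mono Un_insert_left)
qed

text \<open>The ends are kept in \<open>C\<close> because \<open>C\<close> will be a clique: such
  paths can be concatenated across sectors and finally closed into a cycle.\<close>

definition spanning_path :: "('a \<Rightarrow> 'a \<Rightarrow> bool) \<Rightarrow> 'a set \<Rightarrow> 'a set \<Rightarrow> bool" where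
  "spanning_path E C V \<longleftrightarrow> (\<exists>p. p \<noteq> [] \<and> distinct p \<and> set p = V \<and> successively E p \<and>
     hd p \<in> C \<and> last p \<in> C)"

text \<open>Two points of \<open>A\<close> are set aside as the ends. The other
  \<open>card A - 2\<close> points have to merge \<open>m\<close> paths into one, which is possible
  as soon as \<open>m < card A\<close>.\<close>

lemma spanning_path_if_dominating:
  assumes "finite A" "covers E V m" "A \<inter> V = {}" "m < card A" "0 < m"
    and adj: "\<And>a u. a \<in> A \<Longrightarrow> u \<in> A \<union> V \<Longrightarrow> E a u \<and> E u a"
  shows "spanning_path E A (A \<union> V)"
proof -
  have "2 \<le> card A" using assms by linarith
  then obtain a b where ab: "a \<in> A" "b \<in> A" "a \<noteq> b"
    by (metis One_nat_def card.empty card_le_Suc0_iff_eq assms(1) not_less_eq_eq numeral_2_eq_2)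
  let ?B = "A - {a, b}"
  have "card ?B = card A - 2" using ab assms(1) by (simp add: card_Diff_subset)
  moreover have "covers E (?B \<union> V) (max 1 (m - card ?B))"
    by (rule covers_Un_dominating) (use assms in auto)
  moreover have "max 1 (m - (card A - 2)) = 1" using assms(4) by linarith
  ultimately have "covers E (?B \<union> V) 1" by simp
  then obtain ps where ps: "length ps \<le> 1" "distinct (concat ps)" "set (concat ps) = ?B \<union> V"
    "\<And>p. p \<in> set ps \<Longrightarrow> successively E p"
    by (elim coversE) blast
  define p where "p = concat ps"
  have p: "distinct p" "set p = ?B \<union> V" using ps p_def by auto
  have sp: "successively E p"
    using ps(1,4) unfolding p_def by (cases ps) (auto simp: Suc_le_eq)
  have "successively E (p @ [b])"
    by (rule successively_link) (use sp p ab adj in auto)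
  moreover have "E a u \<and> E u a" if "u \<in> set (p @ [b])" for u
    by (rule adj) (use that p ab in auto)
  ultimately have "successively E ([] @ a # (p @ [b]))"
    by (intro successively_link[of E "[]" "p @ [b]" a]) auto
  moreover have "distinct (a # p @ [b])" "set (a # p @ [b]) = A \<union> V"
    using p ab assms(3) by auto
  ultimately show ?thesis
    unfolding spanning_path_def using ab by (intro exI[of _ "a # p @ [b]"]) auto
qed

lemma spanning_path_Un:
  assumes "spanning_path E C V" "spanning_path E C W" "V \<inter> W = {}"
    and "\<And>u v. u \<in> C \<Longrightarrow> v \<in> C \<Longrightarrow> E u v"
  shows "spanning_path E C (V \<union> W)"
proof -
  obtain p where p: "p \<noteq> []" "distinct p" "set p = V" "successively E p" "hd p \<in> C" "last p \<in> C"
    using assms(1) unfolding spanning_path_def by blast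
  obtain q where q: "q \<noteq> []" "distinct q" "set q = W" "successively E q" "hd q \<in> C" "last q \<in> C"
    using assms(2) unfolding spanning_path_def by blast
  have "successively E (p @ q)"
    using p q assms(4) by (simp add: successively_append_iff)
  then show ?thesis
    unfolding spanning_path_def using p q assms(3) by (intro exI[of _ "p @ q"]) auto
qed

lemma spanning_path_mono: "spanning_path E C V \<Longrightarrow> C \<subseteq> D \<Longrightarrow> spanning_path E D V"
  unfolding spanning_path_def by blast

lemma spanning_path_UN:
  assumes "finite J" "J \<noteq> {}" "\<And>j. j \<in> J \<Longrightarrow> spanning_path E C (V j)"
    and "disjoint_family_on V J" "\<And>u v. u \<in> C \<Longrightarrow> v \<in> C \<Longrightarrow> E u v"
  shows "spanning_path E C (\<Union>j\<in>J. V j)"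
  using assms(1-4)
proof (induction J rule: finite_ne_induct)
  case (singleton j)
  then show ?case by simp
next
  case (insert j J)
  have "spanning_path E C (\<Union>j\<in>J. V j)"
    by (rule insert.IH) (use insert.prems in \<open>auto simp: disjoint_family_on_def\<close>)
  moreover have "V j \<inter> (\<Union>j\<in>J. V j) = {}"
    using insert.prems(2) disjoint_family_on_insert[OF insert.hyps(3)] by metis
  ultimately show ?case
    using spanning_path_Un[OF insert.prems(1)[of j] _ _ assms(5)] by simp
qed

text \<open>\<open>E\<close> may be reflexive, so it has to imply \<open>adj\<close> at distinct
  vertices only. Consecutive entries of a distinct list differ, and \<open>3 \<le> k\<close>
  separates the two ends joined by the closing edge.\<close>

lemma has_hamilton_cycle_if_spanning_path:
  assumes "spanning_path E C {0..<k}" "3 \<le> k"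
    and "\<And>u v. u \<in> C \<Longrightarrow> v \<in> C \<Longrightarrow> E u v"
    and adj: "\<And>u v. u < k \<Longrightarrow> v < k \<Longrightarrow> u \<noteq> v \<Longrightarrow> E u v \<Longrightarrow> adj u v"
  shows "has_hamilton_cycle adj k"
proof -
  obtain p where p: "p \<noteq> []" "distinct p" "set p = {0..<k}" "successively E p" "hd p \<in> C" "last p \<in> C"
    using assms(1) unfolding spanning_path_def by blast
  have len: "length p = k" using distinct_card[OF p(2)] p(3) by simp
  have "bij_betw (\<lambda>i. p ! i) {0..<k} {0..<k}"
    by (rule bij_betw_nth[OF p(2)]) (simp_all only: len p(3) lessThan_atLeast0)
  moreover have "adj (p ! i) (p ! ((i + 1) mod k))" if i: "i < k" for i
  proof (cases "i + 1 < k")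
    case True
    have "E (p ! i) (p ! Suc i)"
      using p(4) True len by (simp add: successively_conv_nth)
    moreover have "p ! i \<noteq> p ! Suc i" "p ! i < k" "p ! Suc i < k"
      using p(2,3) True len nth_mem[of _ p] by (auto simp: nth_eq_iff_index_eq)
    ultimately show ?thesis using adj True by simp
  next
    case False
    then have ik: "i = k - 1" using i by simp
    have "E (last p) (hd p)" using assms(3) p by blast
    then have "E (p ! (k - 1)) (p ! 0)" using p(1) len by (simp add: last_conv_nth hd_conv_nth)
    moreover have "p ! (k - 1) \<noteq> p ! 0" "p ! (k - 1) < k" "p ! 0 < k"
      using p(2,3) assms(2) len nth_mem[of _ p] by (auto simp: nth_eq_iff_index_eq)
    ultimately show ?thesis using adj ik assms(2) by simp
  qed
  ultimately show ?thesis
    unfolding has_hamilton_cycle_def using assms(2) by blast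
qed

section \<open>Cell trees\<close>

datatype 'p cell_tree = Leaf "'p set" | Branch "'p cell_tree" "'p set" "'p cell_tree"

primrec region :: "'p cell_tree \<Rightarrow> 'p set" where
  "region (Leaf S) = S"
| "region (Branch l A r) = A \<union> (region l \<union> region r)"

text \<open>The quantifiers include \<open>p = q\<close>, so the relation intended for
  \<open>E\<close> is the reflexive one, distance at most \<open>R\<close>, and not
  adjacency.\<close>

primrec linked :: "('p \<Rightarrow> 'p \<Rightarrow> bool) \<Rightarrow> 'p cell_tree \<Rightarrow> bool" where
  "linked E (Leaf S) \<longleftrightarrow> (\<forall>p\<in>S. \<forall>q\<in>S. E p q)"
| "linked E (Branch l A r) \<longleftrightarrow> linked E l \<and> linked E r \<and>
     (\<forall>p\<in>A. \<forall>q\<in>region (Branch l A r). E p q \<and> E q p)"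

primrec disjoint_cells :: "'p cell_tree \<Rightarrow> bool" where
  "disjoint_cells (Leaf S) \<longleftrightarrow> True"
| "disjoint_cells (Branch l A r) \<longleftrightarrow> disjoint_cells l \<and> disjoint_cells r \<and>
     A \<inter> (region l \<union> region r) = {} \<and> region l \<inter> region r = {}"

text \<open>Only linking cells are collected. A leaf is a clique and costs one path however many
  points it holds, so its mass never has to be estimated.\<close>

primrec cells :: "'p cell_tree \<Rightarrow> 'p set set" where
  "cells (Leaf S) = {}"
| "cells (Branch l A r) = insert A (cells l \<union> cells r)"

text \<open>If \<open>N A\<close> counts the points in \<open>A\<close>, then \<open>excess N t + 1\<close> paths cover the points of the region:
  each of the \<open>N A\<close> points of the top cell can join two paths, until (truncated subtraction)
  only one path is left.\<close>
primrec excess :: "('p set \<Rightarrow> nat) \<Rightarrow> 'p cell_tree \<Rightarrow> nat" where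
  "excess N (Leaf S) = 0"
| "excess N (Branch l A r) = excess N l + excess N r + 1 - N A"

text \<open>An upper bound for \<open>exp (excess N t)\<close> when \<open>g A = exp (- N A)\<close>; unlike the excess it is
  multilinear in \<open>g\<close>, so its expectation is computable.\<close>
primrec majorant :: "('p set \<Rightarrow> real) \<Rightarrow> 'p cell_tree \<Rightarrow> real" where
  "majorant g (Leaf S) = 1"
| "majorant g (Branch l A r) = 1 + exp 1 * g A * majorant g l * majorant g r"

definition num_points :: "'i set \<Rightarrow> ('i \<Rightarrow> 'p) \<Rightarrow> 'p set \<Rightarrow> nat" where
  "num_points I x A = card {i\<in>I. x i \<in> A}"

lemma covers_region:
  assumes "finite I" "linked E t" "disjoint_cells t"
  shows "covers (\<lambda>i j. E (x i) (x j)) {i\<in>I. x i \<in> region t} (excess (num_points I x) t + 1)"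
  using assms(2,3)
proof (induction t)
  case (Leaf S)
  \<comment> \<open>The points of the leaf act as a dominating set over the empty set, covered by 0
    paths; the floor of 1 then gives a single path.\<close>
  have "covers (\<lambda>i j. E (x i) (x j)) ({i\<in>I. x i \<in> S} \<union> {}) (max 1 (0 - card {i\<in>I. x i \<in> S}))"
    by (rule covers_Un_dominating) (use Leaf assms(1) covers_empty in auto)
  then show ?case by simp
next
  case (Branch l A r)
  let ?V = "\<lambda>B. {i\<in>I. x i \<in> B}" and ?E = "\<lambda>i j. E (x i) (x j)" and ?e = "excess (num_points I x)"
  have "covers ?E (?V (region l) \<union> ?V (region r)) ((?e l + 1) + (?e r + 1))"
    by (rule covers_disjoint_Un) (use Branch in auto)
  then have cov: "covers ?E (?V A \<union> (?V (region l) \<union> ?V (region r)))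
      (max 1 ((?e l + 1) + (?e r + 1) - card (?V A)))"
    by (rule covers_Un_dominating[rotated]) (use Branch.prems assms(1) in auto)
  have eq: "?V (region (Branch l A r)) = ?V A \<union> (?V (region l) \<union> ?V (region r))"
    by auto
  \<comment> \<open>The truncation of \<open>excess\<close> at 0 corresponds to the floor of 1 on
    the number of paths.\<close>
  have "max 1 ((?e l + 1) + (?e r + 1) - card (?V A)) \<le> ?e (Branch l A r) + 1"
    unfolding excess.simps num_points_def by linarith
  then show ?case unfolding eq by (rule covers_mono[OF cov])
qed

lemma spanning_path_region:
  assumes "finite I" "linked E (Branch l A r)" "disjoint_cells (Branch l A r)"
    and "excess (num_points I x) l + excess (num_points I x) r + 2 < num_points I x A"
  shows "spanning_path (\<lambda>i j. E (x i) (x j)) {i\<in>I. x i \<in> A} {i\<in>I. x i \<in> region (Branch l A r)}"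
proof -
  let ?V = "\<lambda>B. {i\<in>I. x i \<in> B}" and ?E = "\<lambda>i j. E (x i) (x j)" and ?e = "excess (num_points I x)"
  have "covers ?E (?V (region l) \<union> ?V (region r)) ((?e l + 1) + (?e r + 1))"
    by (intro covers_disjoint_Un covers_region) (use assms in auto)
  then have "spanning_path ?E (?V A) (?V A \<union> (?V (region l) \<union> ?V (region r)))"
    by (rule spanning_path_if_dominating[rotated]) (use assms in \<open>auto simp: num_points_def\<close>)
  moreover have "?V (region (Branch l A r)) = ?V A \<union> (?V (region l) \<union> ?V (region r))"
    by auto
  ultimately show ?thesis by metis
qed

section \<open>Exponential bound for the excess\<close>

lemma majorant_ge_1: "(\<And>A. g A \<ge> 0) \<Longrightarrow> 1 \<le> majorant g t"
proof (induction t)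
  case (Branch l A r)
  then have "0 \<le> exp 1 * g A * majorant g l * majorant g r"
    by (intro mult_nonneg_nonneg) (auto intro: order_trans[of 0 1])
  then show ?case by simp
qed simp

lemma exp_excess_le_majorant:
  "exp (real (excess N t)) \<le> majorant (\<lambda>A. exp (- real (N A))) t"
proof (induction t)
  case (Branch l A r)
  let ?g = "\<lambda>A. exp (- real (N A))"
  have ge: "1 \<le> majorant ?g t" for t by (rule majorant_ge_1) simp
  \<comment> \<open>Truncated subtraction is a maximum with 0, and exp (max 0 a) \<le> 1 + exp
    a.\<close>
  have "exp (real (excess N (Branch l A r)))
      \<le> 1 + exp (real (excess N l) + real (excess N r) + 1 - real (N A))"
  proof (cases "N A \<le> excess N l + excess N r + 1")
    case True
    then show ?thesis by (simp add: of_nat_diff add_ac)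
  next
    case False
    then show ?thesis by simp
  qed
  also have "exp (real (excess N l) + real (excess N r) + 1 - real (N A))
      = exp 1 * ?g A * (exp (real (excess N l)) * exp (real (excess N r)))"
    by (simp flip: exp_add)
  also have "\<dots> \<le> exp 1 * ?g A * (majorant ?g l * majorant ?g r)"
    using Branch.IH ge[of l] ge[of r] by (intro mult_left_mono mult_mono) auto
  finally show ?case by (simp add: mult_ac)
qed simp

text \<open>Markov's inequality in pointwise form: when the root has too few points, a multiple of
  \<open>majorant - 1\<close> reaches 1. The factor \<open>exp 1\<close> pays for the 2 that
  replaces the 1 of \<open>excess\<close>, since the root cell must also supply the ends of the
  path.\<close>

lemma majorant_Branch_ge_if_excess:
  assumes "N A \<le> excess N l + excess N r + 2"
  shows "1 \<le> exp 1 * (majorant (\<lambda>A. exp (- real (N A))) (Branch l A r) - 1)"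
proof -
  let ?g = "\<lambda>A. exp (- real (N A))"
  have ge: "1 \<le> majorant ?g t" for t by (rule majorant_ge_1) simp
  have "1 \<le> exp (real (excess N l) + real (excess N r) + 2 - real (N A))"
    using assms by simp
  also have "\<dots> = exp 1 * (exp 1 * ?g A * (exp (real (excess N l)) * exp (real (excess N r))))"
    by (simp flip: exp_add)
  also have "\<dots> \<le> exp 1 * (exp 1 * ?g A * (majorant ?g l * majorant ?g r))"
    using exp_excess_le_majorant[of N] ge[of l] ge[of r]
    by (intro mult_left_mono mult_mono) auto
  finally show ?thesis by (simp add: mult_ac)
qed

text \<open>The bound 2 reproduces itself in the recursion, as 1 + (2 * 2) / 4 = 2, and is therefore
  uniform in the depth of the tree.\<close>

lemma majorant_le_2:
  assumes "\<And>A. g A \<ge> 0" "\<And>A. A \<in> cells t \<Longrightarrow> 4 * exp 1 * g A \<le> 1"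
  shows "majorant g t \<le> 2"
  using assms(2)
proof (induction t)
  case (Branch l A r)
  have ge: "1 \<le> majorant g t" for t by (rule majorant_ge_1) (rule assms)
  have "exp 1 * g A * (majorant g l * majorant g r) \<le> exp 1 * g A * (2 * 2)"
    using Branch ge[of l] ge[of r] assms(1)
    by (intro mult_left_mono mult_mono) auto
  also have "\<dots> \<le> 1" using Branch.prems[of A] by simp
  finally show ?case by (simp add: mult_ac)
qed simp

text \<open>The subtrees contribute at most the factor 2 * 2, so the bound is as small as the value
  at the root cell, the fullest one, although deep cells have only boundedly small values.\<close>

lemma majorant_Branch_le:
  assumes "\<And>B. g B \<ge> 0" "\<And>B. B \<in> cells (Branch l A r) \<Longrightarrow> 4 * exp 1 * g B \<le> 1"
  shows "majorant g (Branch l A r) - 1 \<le> 4 * exp 1 * g A"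
proof -
  have ge: "1 \<le> majorant g t" for t by (rule majorant_ge_1) (rule assms)
  have le: "majorant g l \<le> 2" "majorant g r \<le> 2"
    by (rule majorant_le_2; use assms in simp)+
  have "exp 1 * g A * (majorant g l * majorant g r) \<le> exp 1 * g A * (2 * 2)"
    using le ge[of l] ge[of r] assms(1) by (intro mult_left_mono mult_mono) auto
  then show ?thesis by (simp add: mult_ac)
qed

text \<open>The product of the values of \<open>g\<close> at disjoint cells is represented by the union of the cells.\<close>
primrec monomials :: "'p cell_tree \<Rightarrow> (real \<times> 'p set) list" where
  "monomials (Leaf S) = [(1, {})]"
| "monomials (Branch l A r) = (1, {}) #
     concat (map (\<lambda>(c, B). map (\<lambda>(d, C). (exp 1 * c * d, A \<union> (B \<union> C))) (monomials r)) (monomials l))"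

lemma monomials_BranchE:
  assumes "(c, B) \<in> set (monomials (Branch l A r))"
  obtains "B = {}" | c1 B1 c2 B2 where "(c1, B1) \<in> set (monomials l)"
    "(c2, B2) \<in> set (monomials r)" "B = A \<union> (B1 \<union> B2)"
  using assms by auto

lemma monomials_subset_region: "(c, B) \<in> set (monomials t) \<Longrightarrow> B \<subseteq> region t"
proof (induction t arbitrary: c B)
  case (Branch l A r)
  from Branch.prems show ?case
  proof (cases rule: monomials_BranchE)
    case (2 c1 B1 c2 B2)
    then have "B1 \<subseteq> region l" "B2 \<subseteq> region r" using Branch.IH by blast+
    then show ?thesis unfolding 2 by auto
  qed simp
qed simp

lemma monomials_sets:
  assumes "cells t \<subseteq> sets M" "(c, B) \<in> set (monomials t)"
  shows "B \<in> sets M"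
  using assms
proof (induction t arbitrary: c B)
  case (Branch l A r)
  from Branch.prems(2) show ?case
  proof (cases rule: monomials_BranchE)
    case (2 c1 B1 c2 B2)
    then have "B1 \<in> sets M" "B2 \<in> sets M" using Branch by auto
    moreover have "A \<in> sets M" using Branch.prems by simp
    ultimately show ?thesis unfolding 2 by blast
  qed simp
qed simp

lemma sum_list_map_concat: "(\<Sum>x\<leftarrow>concat xss. f x) = (\<Sum>xs\<leftarrow>xss. \<Sum>x\<leftarrow>xs. f x)"
  for f :: "'a \<Rightarrow> 'b::monoid_add"
  by (induction xss) simp_all

text \<open>Applied to two multiplicative functions \<open>g\<close>: the random
  \<open>exp (- N A)\<close> and its Poisson average. One list of monomials represents both, so
  averaging term by term turns the first majorant into the second.\<close>

lemma majorant_eq_sum_monomials: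
  assumes "disjoint_cells t" "cells t \<subseteq> sets M" "g {} = 1"
    and g_Un: "\<And>A B. A \<in> sets M \<Longrightarrow> B \<in> sets M \<Longrightarrow> A \<inter> B = {} \<Longrightarrow> g (A \<union> B) = g A * g B"
  shows "majorant g t = (\<Sum>(c, B)\<leftarrow>monomials t. c * g B)"
  using assms(1,2)
proof (induction t)
  case (Leaf S)
  then show ?case using assms(3) by simp
next
  case (Branch l A r)
  have g_mono: "g (A \<union> (B \<union> C)) = g A * (g B * g C)"
    if BC: "(c, B) \<in> set (monomials l)" "(d, C) \<in> set (monomials r)" for c d B C
  proof -
    have sub: "B \<subseteq> region l" "C \<subseteq> region r" using BC monomials_subset_region by fast+
    have sets: "A \<in> sets M" "B \<in> sets M" "C \<in> sets M"
      using BC monomials_sets[of l M] monomials_sets[of r M] Branch.prems by auto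
    have "A \<inter> (B \<union> C) = {}" "B \<inter> C = {}" using sub Branch.prems by auto
    then show ?thesis using g_Un[OF sets(1), of "B \<union> C"] g_Un[OF sets(2,3)] sets by simp
  qed
  have "majorant g (Branch l A r) = 1 + exp 1 * g A *
      ((\<Sum>(c, B)\<leftarrow>monomials l. c * g B) * (\<Sum>(c, B)\<leftarrow>monomials r. c * g B))"
    using Branch by simp
  also have "\<dots> = 1 + (\<Sum>(c, B)\<leftarrow>monomials l. \<Sum>(d, C)\<leftarrow>monomials r.
      exp 1 * g A * ((c * g B) * (d * g C)))"
    unfolding case_prod_unfold sum_list_const_mult sum_list_mult_const ..
  also have "\<dots> = 1 + (\<Sum>(c, B)\<leftarrow>monomials l. \<Sum>(d, C)\<leftarrow>monomials r.
      exp 1 * c * d * g (A \<union> (B \<union> C)))"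
    by (intro arg_cong[of _ _ "\<lambda>s. 1 + sum_list s"] map_cong arg_cong[of _ _ sum_list] refl)
      (auto simp: case_prod_beta g_mono intro!: arg_cong[of _ _ sum_list] map_cong)
  also have "\<dots> = (\<Sum>(c, B)\<leftarrow>monomials (Branch l A r). c * g B)"
    using assms(3)
    by (simp add: sum_list_map_concat case_prod_unfold comp_def)
  finally show ?case .
qed

section \<open>Hyperbolic distances\<close>

text \<open>For radii u + v and 2 v, with \<open>D\<close> one minus the cosine of the angle, the
  left side is cosh of the distance; so the distance is at most the larger radius. The
  parametrisation is chosen because cosh (u + v) - cosh (u - v) = 2 sinh u sinh v.\<close>

lemma cosh_add_bound:
  fixes u v D :: real
  assumes "0 \<le> v" "v \<le> u" "D \<le> exp (- (2 * v)) / 2"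
  shows "cosh (u - v) + sinh (u + v) * sinh (2 * v) * D \<le> cosh (u + v)"
proof -
  have nn: "0 \<le> sinh u" "0 \<le> sinh v" "0 \<le> cosh v" using assms by simp_all
  have "sinh v * cosh u \<le> cosh v * sinh u"
    using sinh_diff[of u v] sinh_real_nonneg_iff[of "u - v"] assms(2) by (simp add: mult.commute)
  then have 1: "sinh (u + v) \<le> 2 * cosh v * sinh u"
    by (simp add: sinh_add mult.commute)
  have "cosh v \<le> exp v"
    using assms(1) by (simp add: cosh_field_def)
  then have "(cosh v)\<^sup>2 \<le> (exp v)\<^sup>2" by (intro power_mono) auto
  then have 2: "(cosh v)\<^sup>2 * exp (- (2 * v)) \<le> 1"
    by (simp add: exp_minus field_simps flip: exp_double)
  have "sinh (u + v) * sinh (2 * v) * D \<le> sinh (u + v) * sinh (2 * v) * (exp (- (2 * v)) / 2)"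
    using assms by (intro mult_left_mono mult_nonneg_nonneg) auto
  also have "\<dots> \<le> (2 * cosh v * sinh u) * (sinh (2 * v) * (exp (- (2 * v)) / 2))"
    using assms 1 unfolding mult.assoc[of "sinh (u + v)"] by (intro mult_right_mono) auto
  also have "\<dots> = 2 * sinh u * sinh v * ((cosh v)\<^sup>2 * exp (- (2 * v)))"
    by (simp add: sinh_double power2_eq_square)
  also have "\<dots> \<le> 2 * sinh u * sinh v"
    using mult_left_mono[OF 2, of "2 * sinh u * sinh v"] nn by simp
  also have "\<dots> = cosh (u + v) - cosh (u - v)"
    by (simp add: cosh_add cosh_diff)
  finally show ?thesis by simp
qed

lemma one_minus_cos_le: "1 - cos x \<le> x\<^sup>2 / 2" for x :: real
proof -
  have "\<bar>sin (x / 2)\<bar> \<le> \<bar>x / 2\<bar>" by (rule abs_sin_x_le_abs_x)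
  then have "(sin (x / 2))\<^sup>2 \<le> (x / 2)\<^sup>2" by (simp only: abs_le_square_iff)
  moreover have "cos x = 1 - 2 * (sin (x / 2))\<^sup>2" using cos_double_sin[of "x / 2"] by simp
  ultimately show ?thesis by (simp add: power_divide)
qed

lemma hyp_dist_le:
  assumes "0 \<le> r" "0 \<le> s" "0 \<le> R"
    and "cosh (r - s) + sinh r * sinh s * (1 - cos (t - t')) \<le> cosh R"
  shows "hyp_dist (r, t) (s, t') \<le> R"
proof -
  define X where "X = cosh r * cosh s - sinh r * sinh s * cos (t - t')"
  have X: "X = cosh (r - s) + sinh r * sinh s * (1 - cos (t - t'))"
    by (simp add: X_def cosh_diff algebra_simps)
  moreover have "0 \<le> sinh r * sinh s * (1 - cos (t - t'))"
    using assms(1,2) by simp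
  ultimately have "1 \<le> X" using cosh_real_ge_1[of "r - s"] by linarith
  then have "arcosh X \<le> arcosh (cosh R)"
    using assms(4) unfolding X[symmetric]
    by (metis arcosh_real_strict_mono less_eq_real_def)
  then show ?thesis
    using assms(3) by (simp add: hyp_dist_def X_def arcosh_cosh_real)
qed

lemma hyp_dist_sym: "hyp_dist p q = hyp_dist q p"
  using cos_minus[of "snd p - snd q"] by (simp add: hyp_dist_def mult.commute)

text \<open>The distance is even at most \<open>max r s\<close>. The angle is measured against
  \<open>r\<close> alone; if \<open>s\<close> is smaller, exp (- r / 2) is below exp (- s / 2), so
  the condition for the smaller radius holds too.\<close>

lemma hyp_dist_le_if_angle:
  assumes "0 \<le> r" "r \<le> R" "0 \<le> s" "s \<le> R" "\<bar>t - t'\<bar> \<le> exp (- r / 2)"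
  shows "hyp_dist (r, t) (s, t') \<le> R"
proof (rule hyp_dist_le)
  define D where "D = 1 - cos (t - t')"
  have "(t - t')\<^sup>2 \<le> (exp (- r / 2))\<^sup>2"
    using assms(5) by (simp add: abs_le_square_iff[symmetric])
  also have "\<dots> = exp (- r)" by (simp flip: exp_double)
  finally have D: "D \<le> exp (- r) / 2" unfolding D_def using one_minus_cos_le[of "t - t'"] by linarith
  have "cosh (r - s) + sinh r * sinh s * D \<le> cosh (max r s)"
  proof (cases "r \<le> s")
    case True
    have "cosh (s - r) = cosh (r - s)" using cosh_minus[of "r - s"] by simp
    \<comment> \<open>Radii u + v = s and 2 v = r; the other case exchanges the roles.\<close>
    moreover have "cosh (s - r) + sinh s * sinh r * D \<le> cosh s"
      using cosh_add_bound[of "r / 2" "s - r / 2" D] D assms(1) True by simp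
    ultimately show ?thesis using True by (simp only: mult.commute max_absorb2)
  next
    case False
    then have "exp (- r) \<le> exp (- s)" by simp
    then have "D \<le> exp (- s) / 2" using D by linarith
    then show ?thesis
      using cosh_add_bound[of "s / 2" "r - s / 2" D] assms(3) False
      by (simp add: max_def)
  qed
  also have "\<dots> \<le> cosh R"
    using assms by (intro cosh_real_nonneg_le_iff[THEN iffD2]) auto
  finally show "cosh (r - s) + sinh r * sinh s * (1 - cos (t - t')) \<le> cosh R" unfolding D_def .
qed (use assms in auto)

lemma hyp_dist_le_if_add_le:
  assumes "0 \<le> r" "0 \<le> s" "r + s \<le> R"
  shows "hyp_dist (r, t) (s, t') \<le> R"
proof (rule hyp_dist_le)
  have "sinh r * sinh s * (1 - cos (t - t')) \<le> sinh r * sinh s * 2"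
    using assms cos_ge_minus_one[of "t - t'"] by (intro mult_left_mono) auto
  then have "cosh (r - s) + sinh r * sinh s * (1 - cos (t - t')) \<le> cosh (r + s)"
    by (simp add: cosh_diff cosh_add)
  also have "\<dots> \<le> cosh R" using assms by (intro cosh_real_nonneg_le_iff[THEN iffD2]) auto
  finally show "cosh (r - s) + sinh r * sinh s * (1 - cos (t - t')) \<le> cosh R" .
qed (use assms in auto)

section \<open>The dyadic decomposition of a sector\<close>

text \<open>The interval ends follow \<open>polar_disk\<close>, so cutting at a radius or halving an
  angle gives exact partitions.\<close>

definition cell :: "real \<Rightarrow> real \<Rightarrow> real \<Rightarrow> real \<Rightarrow> (real \<times> real) set" where
  "cell lo hi a w = {lo..<hi} \<times> {a<..a + w}"

text \<open>A point at radius less than \<open>rho w\<close> is adjacent to all points within angle \<open>w\<close>.\<close>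
definition rho :: "real \<Rightarrow> real" where
  "rho w = - 2 * ln w"

text \<open>Children start at the outer radius of their parent. A linking cell below the root thus
  occupies the radii from \<open>rho (2 * w)\<close> to \<open>rho w\<close>, a layer of thickness 2
  ln 2.\<close>

primrec sector :: "real \<Rightarrow> nat \<Rightarrow> real \<Rightarrow> real \<Rightarrow> real \<Rightarrow> (real \<times> real) cell_tree" where
  "sector R 0 lo a w = Leaf (cell lo R a w)"
| "sector R (Suc d) lo a w = Branch (sector R d (rho w) a (w / 2)) (cell lo (rho w) a w)
     (sector R d (rho w) (a + w / 2) (w / 2))"

text \<open>\<open>d\<close> is the first level of width at most \<open>exp (- R / 2)\<close>. There
  all points of the disk within one width are adjacent; above it, \<open>rho w < R\<close>, so
  linking cells do not leave the disk.\<close>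

definition depth_ok :: "real \<Rightarrow> nat \<Rightarrow> real \<Rightarrow> bool" where
  "depth_ok R d w \<longleftrightarrow> 0 < w \<and> w / 2 ^ d \<le> exp (- R / 2) \<and> (\<forall>i<d. exp (- R / 2) < w / 2 ^ i)"

lemma depth_ok_Suc:
  assumes "depth_ok R (Suc d) w"
  shows "depth_ok R d (w / 2)" "exp (- R / 2) < w"
proof -
  have "exp (- R / 2) < w / 2 / 2 ^ i" if "i < d" for i
    using assms that unfolding depth_ok_def by (auto dest!: spec[of _ "Suc i"])
  then show "depth_ok R d (w / 2)" using assms unfolding depth_ok_def by auto
  show "exp (- R / 2) < w" using assms unfolding depth_ok_def by (auto dest!: spec[of _ 0])
qed

lemma depth_ok_exists:
  assumes "exp (- R / 2) < w"
  obtains d where "depth_ok R (Suc d) w"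
proof -
  have pos: "0 < w" using assms exp_gt_zero[of "- R / 2"] by linarith
  define P where "P d \<longleftrightarrow> w / 2 ^ d \<le> exp (- R / 2)" for d :: nat
  obtain m :: nat where "w / exp (- R / 2) < 2 ^ m" using real_arch_pow[of 2] by auto
  then have "P m" unfolding P_def by (simp add: field_simps)
  then have "P (LEAST d. P d)" by (rule LeastI)
  moreover have "\<not> P i" if "i < (LEAST d. P d)" for i using that by (rule not_less_Least)
  moreover have "\<not> P 0" using assms by (simp add: P_def)
  ultimately obtain d where d: "P (Suc d)" "\<And>i. i < Suc d \<Longrightarrow> \<not> P i"
    by (metis not0_implies_Suc)
  then have "depth_ok R (Suc d) w" unfolding depth_ok_def P_def not_le using pos by blast
  then show ?thesis by (rule that)
qed

lemma rho_mono: "0 < w \<Longrightarrow> w \<le> w' \<Longrightarrow> rho w' \<le> rho w"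
  by (simp add: rho_def)

lemma rho_less: "exp (- R / 2) < w \<Longrightarrow> rho w < R"
  using ln_less_cancel_iff[of "exp (- R / 2)" w] exp_gt_zero[of "- R / 2"]
  unfolding rho_def ln_exp by linarith

lemma less_rho: "0 < w \<Longrightarrow> r < rho w \<Longrightarrow> w \<le> exp (- r / 2)"
  using ln_ge_iff[of w] exp_ln[of w] exp_le_cancel_iff[of "ln w" "- r / 2"] by (simp add: rho_def)

lemma region_sector:
  assumes "depth_ok R d w" "lo \<le> rho w"
  shows "region (sector R d lo a w) = cell lo R a w"
  using assms
proof (induction d arbitrary: lo a w)
  case (Suc d)
  have w: "0 < w" using Suc.prems unfolding depth_ok_def by blast
  have R: "rho w < R" using rho_less depth_ok_Suc(2) Suc.prems(1) by blast
  have "rho w \<le> rho (w / 2)" using w by (intro rho_mono) auto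
  then have "region (sector R d (rho w) b (w / 2)) = cell (rho w) R b (w / 2)" for b
    using Suc.IH depth_ok_Suc(1)[OF Suc.prems(1)] by blast
  moreover have "cell (rho w) R a (w / 2) \<union> cell (rho w) R (a + w / 2) (w / 2) = cell (rho w) R a w"
    using w by (auto simp: cell_def)
  moreover have "cell lo (rho w) a w \<union> cell (rho w) R a w = cell lo R a w"
    using R Suc.prems(2) by (auto simp: cell_def)
  ultimately show ?case by simp
qed simp

lemma disjoint_cells_sector:
  assumes "depth_ok R d w" "lo \<le> rho w"
  shows "disjoint_cells (sector R d lo a w)"
  using assms
proof (induction d arbitrary: lo a w)
  case (Suc d)
  have w: "0 < w" using Suc.prems unfolding depth_ok_def by blast
  have le: "rho w \<le> rho (w / 2)" using w by (intro rho_mono) auto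
  note d = depth_ok_Suc(1)[OF Suc.prems(1)]
  have reg: "region (sector R d (rho w) b (w / 2)) = cell (rho w) R b (w / 2)" for b
    by (rule region_sector[OF d le])
  have "cell lo (rho w) a w \<inter> (cell (rho w) R a (w / 2) \<union> cell (rho w) R (a + w / 2) (w / 2)) = {}"
    "cell (rho w) R a (w / 2) \<inter> cell (rho w) R (a + w / 2) (w / 2) = {}"
    by (auto simp: cell_def)
  then show ?case using Suc.IH[OF d le] by (simp add: reg)
qed simp

lemma linked_sector:
  assumes "depth_ok R d w" "0 \<le> lo" "lo \<le> rho w"
  shows "linked (\<lambda>p q. hyp_dist p q \<le> R) (sector R d lo a w)"
  using assms
proof (induction d arbitrary: lo a w)
  case 0
  have "hyp_dist (r, t) (s, t') \<le> R" if "(r, t) \<in> cell lo R a w" "(s, t') \<in> cell lo R a w" for r t s t'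
  proof (rule hyp_dist_le_if_angle)
    have "\<bar>t - t'\<bar> \<le> w" "r < R" using that by (auto simp: cell_def)
    moreover have "w \<le> exp (- R / 2)" using 0 by (simp add: depth_ok_def)
    moreover have "exp (- R / 2) \<le> exp (- r / 2)" using \<open>r < R\<close> by simp
    ultimately show "\<bar>t - t'\<bar> \<le> exp (- r / 2)" by linarith
  qed (use that 0 in \<open>auto simp: cell_def\<close>)
  then show ?case by auto
next
  case (Suc d)
  have w: "0 < w" using Suc.prems unfolding depth_ok_def by blast
  have le: "rho w \<le> rho (w / 2)" using w by (intro rho_mono) auto
  have R: "rho w < R" using rho_less depth_ok_Suc(2) Suc.prems(1) by blast
  have "hyp_dist (r, t) (s, t') \<le> R"
    if "(r, t) \<in> cell lo (rho w) a w" "(s, t') \<in> cell lo R a w" for r t s t'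
  proof (rule hyp_dist_le_if_angle)
    have "\<bar>t - t'\<bar> \<le> w" "r < rho w" using that by (auto simp: cell_def)
    then show "\<bar>t - t'\<bar> \<le> exp (- r / 2)" using less_rho[OF w, of r] by linarith
  qed (use that Suc.prems R in \<open>auto simp: cell_def\<close>)
  then have "\<forall>p\<in>cell lo (rho w) a w. \<forall>q\<in>region (sector R (Suc d) lo a w). hyp_dist p q \<le> R"
    unfolding region_sector[OF Suc.prems(1,3)] by auto
  moreover have "linked (\<lambda>p q. hyp_dist p q \<le> R) (sector R d (rho w) b (w / 2))" for b
    using Suc.prems by (intro Suc.IH depth_ok_Suc(1) le) auto
  ultimately show ?case using hyp_dist_sym by simp
qed

text \<open>The inner radius is only bounded by \<open>rho (2 * w')\<close> because the root cell
  starts at 0. This bound and \<open>exp (- R / 2) < w'\<close> are what the mass estimate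
  uses.\<close>

lemma cells_sector:
  assumes "depth_ok R d w" "lo \<le> rho (2 * w)" "0 \<le> lo" "A \<in> cells (sector R d lo a w)"
  obtains lo' a' w' where "A = cell lo' (rho w') a' w'" "0 \<le> lo'" "lo' \<le> rho (2 * w')"
    "exp (- R / 2) < w'" "w' \<le> w" "a \<le> a'" "a' + w' \<le> a + w"
  using assms
proof (induction d arbitrary: lo a w thesis)
  case (Suc d)
  note ok = depth_ok_Suc[OF Suc.prems(2)]
  have w: "0 < w" using Suc.prems unfolding depth_ok_def by blast
  have le: "0 \<le> rho w" using Suc.prems(3,4) rho_mono[of w "2 * w"] w by linarith
  consider "A = cell lo (rho w) a w"
    | b where "b \<in> {a, a + w / 2}" "A \<in> cells (sector R d (rho w) b (w / 2))"
    using Suc.prems(5) by auto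
  then show ?case
  proof cases
    case 1
    then show ?thesis using Suc.prems ok(2) by blast
  next
    case (2 b)
    show ?thesis
    proof (rule Suc.IH[OF _ ok(1) _ le 2(2)])
      fix lo' a' w'
      assume "A = cell lo' (rho w') a' w'" "0 \<le> lo'" "lo' \<le> rho (2 * w')" "exp (- R / 2) < w'"
        "w' \<le> w / 2" "b \<le> a'" "a' + w' \<le> b + w / 2"
      then show thesis using 2(1) w by (intro Suc.prems(1)[of lo' w' a']) auto
    qed simp
  qed
qed simp

lemma cells_sector_sets: "cells (sector R d lo a w) \<subseteq> sets (borel \<Otimes>\<^sub>M borel)"
  by (induction d arbitrary: lo a w) (auto simp: cell_def)

section \<open>Joining the sectors\<close>

definition root_cell :: "nat \<Rightarrow> (real \<times> real) set" where
  "root_cell j = cell 0 (rho (pi / 8)) (real j * pi / 8) (pi / 8)"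

definition root_tree :: "real \<Rightarrow> nat \<Rightarrow> nat \<Rightarrow> (real \<times> real) cell_tree" where
  "root_tree R d j = sector R d 0 (real j * pi / 8) (pi / 8)"

text \<open>This fixes the number of sectors: doubled, the root width pi/8 is still below 1, so the
  root cell contains a full layer from \<open>rho (2 * w)\<close> to \<open>rho w\<close>.\<close>

lemma rho_root: "0 \<le> rho (2 * (pi / 8))" "0 \<le> rho (pi / 8)"
  using pi_less_4 pi_gt_zero by (auto simp: rho_def)

lemma sector_angle_le:
  assumes "j < 16"
  shows "real j * pi / 8 + pi / 8 \<le> 2 * pi"
proof -
  have "(real j + 1) * pi \<le> 16 * pi" using assms by (intro mult_right_mono) auto
  then have "real j * pi + pi \<le> 16 * pi" unfolding distrib_right by simp
  then show ?thesis by linarith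
qed

lemma UN_sectors: "(\<Union>j\<in>{..<16}. cell 0 R (real j * pi / 8) (pi / 8)) = polar_disk R"
proof -
  have "\<exists>j<16. real j * pi / 8 < t \<and> t \<le> real j * pi / 8 + pi / 8" if t: "0 < t" "t \<le> 2 * pi" for t
  proof -
    \<comment> \<open>Sectors are open on the left, so the index is a ceiling minus one.\<close>
    define z where "z = \<lceil>8 * t / pi\<rceil>"
    have "of_int z - 1 < 8 * t / pi" "8 * t / pi \<le> of_int z" unfolding z_def by linarith+
    moreover have "0 < 8 * t / pi" "8 * t / pi \<le> 16" using t by (auto simp: field_simps)
    ultimately have z: "1 \<le> z" "z \<le> 16" unfolding z_def by (linarith, simp add: ceiling_le_iff)
    define j where "j = nat (z - 1)"
    have j: "real j = of_int z - 1" using z by (simp add: j_def)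
    have "real j * pi < 8 * t" "8 * t \<le> (real j + 1) * pi"
      using \<open>of_int z - 1 < 8 * t / pi\<close> \<open>8 * t / pi \<le> of_int z\<close> unfolding j
      by (simp_all add: field_simps)
    moreover have "j < 16" using z by (simp add: j_def)
    ultimately show ?thesis by (intro exI[of _ j]) (auto simp: algebra_simps)
  qed
  moreover have "0 < t \<and> t \<le> 2 * pi"
    if "j < 16" "real j * pi / 8 < t" "t \<le> real j * pi / 8 + pi / 8" for j t
  proof -
    have "real j * pi / 8 + pi / 8 \<le> 2 * pi" using that(1) by (rule sector_angle_le)
    moreover have "0 \<le> real j * pi / 8" by simp
    ultimately show ?thesis using that by linarith
  qed
  ultimately show ?thesis by (fastforce simp: cell_def polar_disk_def)
qed

lemma disjoint_sectors: "disjoint_family_on (\<lambda>j. cell 0 R (real j * pi / 8) (pi / 8)) {..<16}"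
proof -
  have *: "cell 0 R (real i * pi / 8) (pi / 8) \<inter> cell 0 R (real j * pi / 8) (pi / 8) = {}"
    if "i < j" for i j
  proof -
    have "(real i + 1) * pi \<le> real j * pi" using that by (intro mult_right_mono) auto
    then have "real i * pi / 8 + pi / 8 \<le> real j * pi / 8" by (simp add: algebra_simps)
    then show ?thesis by (auto simp: cell_def)
  qed
  show ?thesis
    unfolding disjoint_family_on_def using * by (metis Int_commute linorder_neqE_nat)
qed

text \<open>The deterministic core. Injectivity turns distance at most \<open>R\<close> between
  distinct indices into adjacency, and \<open>2 * rho (pi / 8) \<le> R\<close> makes the points of
  the root cells a clique through the centre.\<close>

lemma has_hamilton_cycle_if_excess:
  assumes R: "2 * rho (pi / 8) \<le> R" and ok: "depth_ok R (Suc d) (pi / 8)"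
    and inj: "inj_on x {0..<k}" and disk: "\<And>i. i < k \<Longrightarrow> x i \<in> polar_disk R"
    and exc: "\<And>j l A r. j < 16 \<Longrightarrow> root_tree R (Suc d) j = Branch l A r \<Longrightarrow>
      excess (num_points {0..<k} x) l + excess (num_points {0..<k} x) r + 2 < num_points {0..<k} x A"
  shows "has_hamilton_cycle (\<lambda>i j. kpkvb_adj R (x i) (x j)) k"
proof -
  define E where "E i j \<longleftrightarrow> hyp_dist (x i) (x j) \<le> R" for i j
  define C where "C = {i\<in>{0..<k}. \<exists>j<16. x i \<in> root_cell j}"
  define V where "V j = {i\<in>{0..<k}. x i \<in> cell 0 R (real j * pi / 8) (pi / 8)}" for j :: nat
  have E_C: "E u v" if "u \<in> C" "v \<in> C" for u v
  proof -
    obtain r t s t' where x: "x u = (r, t)" "x v = (s, t')" by fastforce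
    then have "0 \<le> r" "r < rho (pi / 8)" "0 \<le> s" "s < rho (pi / 8)"
      using that by (auto simp: C_def root_cell_def cell_def)
    then show ?thesis using R unfolding E_def x by (intro hyp_dist_le_if_add_le) auto
  qed
  have sp: "spanning_path E C (V j)" if j: "j < 16" for j
  proof -
    obtain l r where lr: "root_tree R (Suc d) j = Branch l (root_cell j) r"
      by (simp add: root_tree_def root_cell_def)
    have "linked (\<lambda>p q. hyp_dist p q \<le> R) (root_tree R (Suc d) j)"
      "disjoint_cells (root_tree R (Suc d) j)"
      "region (root_tree R (Suc d) j) = cell 0 R (real j * pi / 8) (pi / 8)"
      unfolding root_tree_def
      using linked_sector[OF ok _ rho_root(2)] disjoint_cells_sector[OF ok rho_root(2)]
        region_sector[OF ok rho_root(2)] by blast+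
    then have "spanning_path (\<lambda>i j. hyp_dist (x i) (x j) \<le> R) {i\<in>{0..<k}. x i \<in> root_cell j}
        {i\<in>{0..<k}. x i \<in> cell 0 R (real j * pi / 8) (pi / 8)}"
      using spanning_path_region[of "{0..<k}" "\<lambda>p q. hyp_dist p q \<le> R" l "root_cell j" r x] exc[OF j lr]
      unfolding lr by simp
    then have "spanning_path E {i\<in>{0..<k}. x i \<in> root_cell j} (V j)"
      unfolding E_def V_def .
    then show ?thesis by (rule spanning_path_mono) (use j in \<open>auto simp: C_def\<close>)
  qed
  have disj: "disjoint_family_on V {..<16}"
    using disjoint_sectors[of R] unfolding disjoint_family_on_def V_def by blast
  have "spanning_path E C (\<Union>j\<in>{..<16}. V j)"
  proof (rule spanning_path_UN[OF _ _ _ disj])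
    show "spanning_path E C (V j)" if "j \<in> {..<16}" for j using that sp by simp
  qed (use E_C in \<open>auto simp: lessThan_empty_iff\<close>)
  moreover have "(\<Union>j\<in>{..<16}. V j) = {0..<k}"
    using disk unfolding V_def UN_sectors[of R, symmetric] by auto
  ultimately have span: "spanning_path E C {0..<k}" by simp
  obtain l r where "root_tree R (Suc d) 0 = Branch l (root_cell 0) r"
    by (simp add: root_tree_def root_cell_def)
  from exc[OF _ this] have "3 \<le> num_points {0..<k} x (root_cell 0)" by simp
  also have "\<dots> \<le> card {0..<k}" unfolding num_points_def by (intro card_mono) auto
  finally have "3 \<le> k" by simp
  with span show ?thesis
  proof (rule has_hamilton_cycle_if_spanning_path)
    show "E u v" if "u \<in> C" "v \<in> C" for u v using that by (rule E_C)
    show "kpkvb_adj R (x u) (x v)" if "u < k" "v < k" "u \<noteq> v" "E u v" for u v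
      using that inj unfolding kpkvb_adj_def E_def inj_on_def by auto
  qed
qed

section \<open>The point distribution\<close>

lemma measurable_f_dens [measurable]: "f_dens \<alpha> R \<in> borel_measurable borel"
proof -
  have eq: "f_dens \<alpha> R = (\<lambda>p. \<alpha> / (2 * pi * (cosh (\<alpha> * R) - 1)) * sinh (\<alpha> * fst p))"
    by (simp add: f_dens_def fun_eq_iff)
  show ?thesis
    unfolding eq by (intro borel_measurable_continuous_onI continuous_intros)
qed

lemma polar_disk_borel [measurable]: "polar_disk R \<in> sets borel"
  unfolding polar_disk_def by (subst borel_prod[symmetric]) simp

lemma cell_borel [measurable]: "cell lo hi a w \<in> sets borel"
  unfolding cell_def by (subst borel_prod[symmetric]) simp

lemma sets_point_dist [measurable_cong, simp]: "sets (point_dist \<alpha> R) = sets borel"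
  by (simp add: point_dist_def)

lemma space_point_dist [simp]: "space (point_dist \<alpha> R) = UNIV"
  by (simp add: point_dist_def)

lemma emeasure_point_dist_cell:
  assumes "0 < \<alpha>" "0 < R" "0 \<le> lo" "lo \<le> hi" "hi \<le> R" "0 \<le> a" "0 \<le> w" "a + w \<le> 2 * pi"
  shows "emeasure (point_dist \<alpha> R) (cell lo hi a w) =
    ennreal (w * (cosh (\<alpha> * hi) - cosh (\<alpha> * lo)) / (2 * pi * (cosh (\<alpha> * R) - 1)))"
proof -
  define K where "K = 2 * pi * (cosh (\<alpha> * R) - 1)"
  have "cosh (\<alpha> * R) > 1" using cosh_real_nonneg_less_iff[of 0 "\<alpha> * R"] assms by simp
  then have K: "K > 0" by (simp add: K_def)
  define f where "f r = \<alpha> * sinh (\<alpha> * r) / K" for r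
  have f_meas [measurable]: "f \<in> borel_measurable borel"
    unfolding f_def by (intro borel_measurable_continuous_onI continuous_intros) (use K in auto)
  have f_nonneg: "0 \<le> f r" if "0 \<le> r" for r
    using that assms K unfolding f_def by auto
  have "emeasure (point_dist \<alpha> R) (cell lo hi a w) =
      (\<integral>\<^sup>+p. ennreal (indicator (polar_disk R) p * f_dens \<alpha> R p) * indicator (cell lo hi a w) p \<partial>lborel)"
    unfolding point_dist_def by (rule emeasure_density) (simp_all add: measurable_f_dens)
  also have "\<dots> = (\<integral>\<^sup>+p. (ennreal (f (fst p)) * indicator {lo..<hi} (fst p)) * indicator {a<..a + w} (snd p) \<partial>lborel)"
    using assms by (intro nn_integral_cong)
      (auto simp: polar_disk_def cell_def f_dens_def f_def K_def indicator_def split: if_splits)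
  also have "\<dots> = (\<integral>\<^sup>+p. (ennreal (f (fst p)) * indicator {lo..<hi} (fst p)) * indicator {a<..a + w} (snd p)
      \<partial>(lborel \<Otimes>\<^sub>M lborel))"
    by (simp add: lborel_prod)
  also have "\<dots> = (\<integral>\<^sup>+r. \<integral>\<^sup>+t. (ennreal (f r) * indicator {lo..<hi} r) * indicator {a<..a + w} t \<partial>lborel \<partial>lborel)"
    by (subst lborel.nn_integral_fst[symmetric]) simp_all
  also have "\<dots> = (\<integral>\<^sup>+r. (ennreal (f r) * indicator {lo..<hi} r) * ennreal w \<partial>lborel)"
    using assms by (intro nn_integral_cong) (simp add: nn_integral_cmult)
  also have "\<dots> = (\<integral>\<^sup>+r. ennreal (f r) * indicator {lo..<hi} r \<partial>lborel) * ennreal w"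
    by (simp add: nn_integral_multc)
  \<comment> \<open>The endpoint is a null set; the fundamental theorem of calculus wants a closed
    interval.\<close>
  also have "(\<integral>\<^sup>+r. ennreal (f r) * indicator {lo..<hi} r \<partial>lborel) = (\<integral>\<^sup>+r. ennreal (f r) * indicator {lo..hi} r \<partial>lborel)"
    by (intro nn_integral_cong_AE eventually_mono[OF AE_lborel_singleton[of hi]])
      (auto simp: indicator_def)
  also have "\<dots> = ennreal (cosh (\<alpha> * hi) / K - cosh (\<alpha> * lo) / K)"
  proof (rule nn_integral_FTC_Icc)
    show "((\<lambda>r. cosh (\<alpha> * r) / K) has_real_derivative f r) (at r)" for r
      unfolding f_def using K by (auto intro!: derivative_eq_intros)
  qed (use assms f_nonneg in auto)
  also have "\<dots> * ennreal w = ennreal ((cosh (\<alpha> * hi) / K - cosh (\<alpha> * lo) / K) * w)"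
    using assms by (simp add: ennreal_mult'')
  also have "(cosh (\<alpha> * hi) / K - cosh (\<alpha> * lo) / K) * w = w * (cosh (\<alpha> * hi) - cosh (\<alpha> * lo)) / K"
    by (simp add: diff_divide_distrib right_diff_distrib mult.commute)
  finally show ?thesis by (simp add: K_def)
qed

lemma polar_disk_eq_cell: "polar_disk R = cell 0 R 0 (2 * pi)"
  by (simp add: polar_disk_def cell_def)

lemma emeasure_point_dist_disk:
  assumes "0 < \<alpha>" "0 < R"
  shows "emeasure (point_dist \<alpha> R) (polar_disk R) = 1"
proof -
  have "cosh (\<alpha> * R) > 1" using cosh_real_nonneg_less_iff[of 0 "\<alpha> * R"] assms by simp
  then show ?thesis
    unfolding polar_disk_eq_cell using assms by (subst emeasure_point_dist_cell) auto
qed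

lemma emeasure_point_dist_UNIV: "emeasure (point_dist \<alpha> R) UNIV = emeasure (point_dist \<alpha> R) (polar_disk R)"
  unfolding point_dist_def
  by (subst (1 2) emeasure_density) (auto intro!: nn_integral_cong simp: measurable_f_dens indicator_def)

lemma prob_space_point_dist:
  assumes "0 < \<alpha>" "0 < R"
  shows "prob_space (point_dist \<alpha> R)"
  by standard (simp add: emeasure_point_dist_UNIV emeasure_point_dist_disk[OF assms])

lemma AE_point_dist_disk: "AE p in point_dist \<alpha> R. p \<in> polar_disk R"
  unfolding point_dist_def by (subst AE_density) (auto simp: measurable_f_dens indicator_def)

lemma emeasure_point_dist_singleton: "emeasure (point_dist \<alpha> R) {p} = 0"
proof -
  have "AE q in lborel. q \<noteq> p" by (rule AE_lborel_singleton)
  then have "AE q in point_dist \<alpha> R. q \<noteq> p"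
    unfolding point_dist_def by (subst AE_density) (auto simp: measurable_f_dens)
  then show ?thesis
    by (subst (asm) AE_iff_measurable[of "{p}"]) auto
qed

section \<open>Independent points\<close>

text \<open>Fubini: with the other coordinates fixed, coordinate \<open>i\<close> must avoid the
  single point \<open>x j\<close>, which has mass 0.\<close>

lemma AE_PiM_inj_on:
  fixes M :: "'a::{second_countable_topology, t2_space} measure"
  assumes "prob_space M" "sets M = sets borel" "\<And>p. emeasure M {p} = 0" "finite I"
  shows "AE x in PiM I (\<lambda>_. M). inj_on x I"
proof -
  interpret prob_space M by fact
  interpret product_prob_space "\<lambda>_. M" I by standard
  note [measurable_cong] = assms(2)
  have "AE x in PiM I (\<lambda>_. M). x i \<noteq> x j" if ij: "i \<in> I" "j \<in> I" "i \<noteq> j" for i j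
  proof -
    define J where "J = I - {i}"
    have J: "finite J" "i \<notin> J" "j \<in> J" "I = insert i J" using ij assms(4) by (auto simp: J_def)
    define S where "S = {x \<in> space (PiM I (\<lambda>_. M)). x i = x j}"
    have S [measurable]: "S \<in> sets (PiM I (\<lambda>_. M))" unfolding S_def using ij by measurable
    have "emeasure (PiM I (\<lambda>_. M)) S = (\<integral>\<^sup>+x. indicator S x \<partial>PiM I (\<lambda>_. M))"
      using S by simp
    also have "\<dots> = (\<integral>\<^sup>+x. (\<integral>\<^sup>+y. indicator S (x(i := y)) \<partial>M) \<partial>PiM J (\<lambda>_. M))"
      unfolding J(4) using J(1,2) S[unfolded J(4)] by (intro product_nn_integral_insert) auto
    also have "\<dots> \<le> (\<integral>\<^sup>+x. (\<integral>\<^sup>+y. indicator {x j} y \<partial>M) \<partial>PiM J (\<lambda>_. M))"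
      using ij by (intro nn_integral_mono) (auto simp: S_def indicator_def)
    also have "\<dots> = 0" using assms(2,3) by simp
    finally have "emeasure (PiM I (\<lambda>_. M)) S = 0" by simp
    then show ?thesis
      by (subst AE_iff_measurable[OF S]) (auto simp: S_def)
  qed
  then have "AE x in PiM I (\<lambda>_. M). \<forall>i\<in>I. \<forall>j\<in>I. i \<noteq> j \<longrightarrow> x i \<noteq> x j"
    using assms(4) by (simp add: AE_finite_all)
  then show ?thesis by eventually_elim (auto simp: inj_on_def)
qed

lemma exp_neg_count:
  assumes "finite I"
  shows "exp (- real (num_points I x A)) = (\<Prod>i\<in>I. exp (- indicator A (x i)))"
proof -
  have "real (num_points I x A) = (\<Sum>i\<in>I. indicator A (x i))"
    using assms by (simp add: num_points_def indicator_def sum.If_cases Int_def)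
  then show ?thesis using assms by (simp add: exp_sum flip: sum_negf)
qed

context prob_space
begin

lemma integrable_exp_neg_indicator:
  assumes "A \<in> sets M"
  shows "integrable M (\<lambda>p. exp (- indicator A p) :: real)"
  using assms by (intro integrable_const_bound[where B=1]) (auto simp: indicator_def)

lemma integral_exp_neg_indicator:
  assumes "A \<in> sets M"
  shows "(\<integral>p. exp (- indicator A p) \<partial>M) = 1 - (1 - exp (-1)) * prob A"
proof -
  have "(\<integral>p. exp (- indicator A p) \<partial>M) = (\<integral>p. 1 - (1 - exp (-1)) * indicator A p \<partial>M)"
    by (intro Bochner_Integration.integral_cong) (auto simp: indicator_def)
  also have "\<dots> = 1 - (1 - exp (-1)) * prob A"
  proof -
    have "integrable M (indicat_real A)" using assms by (simp add: emeasure_eq_measure)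
    then show ?thesis using assms by (subst Bochner_Integration.integral_diff) (auto simp: prob_space)
  qed
  finally show ?thesis .
qed

lemma
  assumes "A \<in> sets M" "finite I"
  shows integrable_exp_neg_count: "integrable (PiM I (\<lambda>_. M)) (\<lambda>x. exp (- real (num_points I x A)))"
    and integral_exp_neg_count:
      "(\<integral>x. exp (- real (num_points I x A)) \<partial>PiM I (\<lambda>_. M)) = (1 - (1 - exp (-1)) * prob A) ^ card I"
proof -
  note int = integrable_exp_neg_indicator[OF assms(1)] integral_exp_neg_indicator[OF assms(1)]
  interpret product_sigma_finite "\<lambda>_. M" by standard
  show "integrable (PiM I (\<lambda>_. M)) (\<lambda>x. exp (- real (num_points I x A)))"
    unfolding exp_neg_count[OF assms(2)]
    by (rule product_integrable_prod[OF assms(2)]) (rule int(1))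
  show "(\<integral>x. exp (- real (num_points I x A)) \<partial>PiM I (\<lambda>_. M)) = (1 - (1 - exp (-1)) * prob A) ^ card I"
    unfolding exp_neg_count[OF assms(2)]
    by (subst product_integral_prod[OF assms(2)])
      (simp_all add: int)
qed

lemma exp_neg_count_Un:
  assumes "finite I" "A \<inter> B = {}"
  shows "exp (- real (num_points I x (A \<union> B))) = exp (- real (num_points I x A)) * exp (- real (num_points I x B))"
proof -
  have "{i\<in>I. x i \<in> A \<union> B} = {i\<in>I. x i \<in> A} \<union> {i\<in>I. x i \<in> B}" by auto
  then have "num_points I x (A \<union> B) = num_points I x A + num_points I x B"
    unfolding num_points_def using assms by (simp add: card_Un_disjoint disjoint_iff)
  then show ?thesis by (simp add: mult_exp_exp)
qed

lemma
  assumes "disjoint_cells t" "cells t \<subseteq> sets M" "finite I"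
  shows integrable_majorant:
      "integrable (PiM I (\<lambda>_. M)) (\<lambda>x. majorant (\<lambda>A. exp (- real (num_points I x A))) t)"
    and integral_majorant:
      "(\<integral>x. majorant (\<lambda>A. exp (- real (num_points I x A))) t \<partial>PiM I (\<lambda>_. M)) =
       (\<Sum>(c, B)\<leftarrow>monomials t. c * (1 - (1 - exp (-1)) * prob B) ^ card I)"
proof -
  have eq: "majorant (\<lambda>A. exp (- real (num_points I x A))) t =
      (\<Sum>(c, B)\<leftarrow>monomials t. c * exp (- real (num_points I x B)))" for x
    by (rule majorant_eq_sum_monomials[OF assms(1,2)])
      (auto simp: num_points_def[of _ _ "{}"] intro!: exp_neg_count_Un assms(3))
  \<comment> \<open>Stated for an arbitrary list of measurable sets, so that the induction is over
    the list and not over the tree.\<close>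
  have "integrable (PiM I (\<lambda>_. M)) (\<lambda>x. \<Sum>(c, B)\<leftarrow>xs. c * exp (- real (num_points I x B))) \<and>
      (\<integral>x. (\<Sum>(c, B)\<leftarrow>xs. c * exp (- real (num_points I x B))) \<partial>PiM I (\<lambda>_. M)) =
       (\<Sum>(c, B)\<leftarrow>xs. c * (1 - (1 - exp (-1)) * prob B) ^ card I)"
    if "\<And>c B. (c, B) \<in> set xs \<Longrightarrow> B \<in> sets M" for xs
    using that
  proof (induction xs)
    case (Cons cB xs)
    obtain c B where cB: "cB = (c, B)" by fastforce
    then have B: "B \<in> sets M" using Cons.prems[of c B] by simp
    have "integrable (PiM I (\<lambda>_. M)) (\<lambda>x. \<Sum>(c, B)\<leftarrow>xs. c * exp (- real (num_points I x B))) \<and>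
      (\<integral>x. (\<Sum>(c, B)\<leftarrow>xs. c * exp (- real (num_points I x B))) \<partial>PiM I (\<lambda>_. M)) =
       (\<Sum>(c, B)\<leftarrow>xs. c * (1 - (1 - exp (-1)) * prob B) ^ card I)"
      by (rule Cons.IH) (use Cons.prems in auto)
    then show ?case
      using integrable_exp_neg_count[OF B assms(3)] integral_exp_neg_count[OF B assms(3)]
      unfolding cB by simp
  qed simp
  from this[of "monomials t"] monomials_sets[OF assms(2)]
  show "integrable (PiM I (\<lambda>_. M)) (\<lambda>x. majorant (\<lambda>A. exp (- real (num_points I x A))) t)"
    "(\<integral>x. majorant (\<lambda>A. exp (- real (num_points I x A))) t \<partial>PiM I (\<lambda>_. M)) =
       (\<Sum>(c, B)\<leftarrow>monomials t. c * (1 - (1 - exp (-1)) * prob B) ^ card I)"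
    unfolding eq by blast+
qed

text \<open>The Poisson generating function sends (1 - q)^k to exp (- s q). As q is additive over
  disjoint sets, the result is multiplicative and folds back into a majorant.\<close>

lemma poisson_integral_majorant:
  assumes "disjoint_cells t" "cells t \<subseteq> sets M"
  shows "(\<lambda>k. exp (- s) * s ^ k / fact k *
      (\<integral>x. majorant (\<lambda>A. exp (- real (num_points {0..<k} x A))) t \<partial>PiM {0..<k} (\<lambda>_. M)))
    sums majorant (\<lambda>A. exp (- s * (1 - exp (-1)) * prob A)) t"
proof -
  define q where "q B = (1 - exp (-1)) * prob B" for B
  have "(\<lambda>k. exp (- s) * s ^ k / fact k * (c * (1 - q B) ^ k)) sums (c * exp (- s * (1 - exp (-1)) * prob B))"
    for c B
  proof -
    have "(\<lambda>k. (s * (1 - q B)) ^ k /\<^sub>R fact k) sums exp (s * (1 - q B))" by (rule exp_converges)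
    then have "(\<lambda>k. c * exp (- s) * ((s * (1 - q B)) ^ k /\<^sub>R fact k)) sums (c * exp (- s) * exp (s * (1 - q B)))"
      by (rule sums_mult)
    moreover have "exp (- s) * exp (s * (1 - q B)) = exp (- s * (1 - exp (-1)) * prob B)"
      by (simp add: q_def algebra_simps flip: exp_add)
    ultimately show ?thesis
      by (simp add: power_mult_distrib divide_inverse mult_ac)
  qed
  then have "(\<lambda>k. exp (- s) * s ^ k / fact k * (\<Sum>(c, B)\<leftarrow>xs. c * (1 - q B) ^ k))
      sums (\<Sum>(c, B)\<leftarrow>xs. c * exp (- s * (1 - exp (-1)) * prob B))" for xs
  proof (induction xs)
    case (Cons cB xs)
    then show ?case
      by (cases cB) (auto simp: distrib_left intro!: sums_add)
  qed simp
  moreover have "majorant (\<lambda>A. exp (- s * (1 - exp (-1)) * prob A)) t =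
      (\<Sum>(c, B)\<leftarrow>monomials t. c * exp (- s * (1 - exp (-1)) * prob B))"
    by (rule majorant_eq_sum_monomials[OF assms])
      (auto simp: finite_measure_Union distrib_left mult_exp_exp)
  ultimately show ?thesis
    by (simp add: integral_majorant[OF assms] q_def)
qed

end

section \<open>The failure probability\<close>

text \<open>For measurability: restricted to extensional functions, the existential ranges over a
  finite set, so the event is a finite union.\<close>

lemma has_hamilton_cycle_iff_PiE:
  "has_hamilton_cycle adj k \<longleftrightarrow> 3 \<le> k \<and> (\<exists>\<sigma>\<in>{0..<k} \<rightarrow>\<^sub>E {0..<k}. bij_betw \<sigma> {0..<k} {0..<k} \<and>
     (\<forall>i\<in>{0..<k}. adj (\<sigma> i) (\<sigma> ((i + 1) mod k))))"
proof
  assume "has_hamilton_cycle adj k"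
  then obtain \<sigma> where k: "3 \<le> k" and \<sigma>: "bij_betw \<sigma> {0..<k} {0..<k}" "\<forall>i<k. adj (\<sigma> i) (\<sigma> ((i + 1) mod k))"
    unfolding has_hamilton_cycle_def by blast
  let ?\<tau> = "restrict \<sigma> {0..<k}"
  have "bij_betw ?\<tau> {0..<k} {0..<k}" using \<sigma>(1) by simp
  moreover have "?\<tau> \<in> {0..<k} \<rightarrow>\<^sub>E {0..<k}" using \<sigma>(1) by (auto dest: bij_betwE)
  moreover have "\<forall>i\<in>{0..<k}. adj (?\<tau> i) (?\<tau> ((i + 1) mod k))" using \<sigma>(2) by simp
  ultimately show "3 \<le> k \<and> (\<exists>\<sigma>\<in>{0..<k} \<rightarrow>\<^sub>E {0..<k}. bij_betw \<sigma> {0..<k} {0..<k} \<and>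
     (\<forall>i\<in>{0..<k}. adj (\<sigma> i) (\<sigma> ((i + 1) mod k))))" using k by blast
next
  assume "3 \<le> k \<and> (\<exists>\<sigma>\<in>{0..<k} \<rightarrow>\<^sub>E {0..<k}. bij_betw \<sigma> {0..<k} {0..<k} \<and>
     (\<forall>i\<in>{0..<k}. adj (\<sigma> i) (\<sigma> ((i + 1) mod k))))"
  then show "has_hamilton_cycle adj k"
    unfolding has_hamilton_cycle_def by (auto simp: Ball_def)
qed

lemma measurable_hyp_dist [measurable (raw)]:
  assumes "f \<in> borel_measurable N" "g \<in> borel_measurable N"
  shows "(\<lambda>x. hyp_dist (f x) (g x)) \<in> borel_measurable N"
proof -
  define G :: "(real \<times> real) \<times> (real \<times> real) \<Rightarrow> real" where
    "G z = cosh (fst (fst z)) * cosh (fst (snd z)) - sinh (fst (fst z)) * sinh (fst (snd z)) *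
      cos (snd (fst z) - snd (snd z))" for z
  have "G \<in> borel_measurable borel"
    unfolding G_def by (intro borel_measurable_continuous_onI continuous_intros)
  from measurable_compose[OF borel_measurable_Pair[OF assms] this]
  have [measurable]: "(\<lambda>x. G (f x, g x)) \<in> borel_measurable N" .
  have "hyp_dist (f x) (g x) = ln (G (f x, g x) + ((G (f x, g x))\<^sup>2 - 1) powr (1 / 2))" for x
    by (simp add: hyp_dist_def arcosh_def G_def)
  then show ?thesis by simp
qed

lemma pred_kpkvb_adj:
  assumes [measurable]: "f \<in> borel_measurable N" "g \<in> borel_measurable N"
  shows "Measurable.pred N (\<lambda>x. kpkvb_adj R (f x) (g x))"
  unfolding kpkvb_adj_def by measurable

lemma hamilton_event_sets:
  "{x \<in> space (PiM {0..<k} (\<lambda>_. point_dist \<alpha> R)). has_hamilton_cycle (\<lambda>i j. kpkvb_adj R (x i) (x j)) k}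
   \<in> sets (PiM {0..<k} (\<lambda>_. point_dist \<alpha> R))"
proof -
  let ?P = "PiM {0..<k} (\<lambda>_. point_dist \<alpha> R)"
  have comp: "(\<lambda>x. x i) \<in> borel_measurable ?P" if "i \<in> {0..<k}" for i
    using measurable_component_singleton[OF that, of "\<lambda>_. point_dist \<alpha> R"]
    by (simp cong: measurable_cong_sets)
  have "Measurable.pred ?P (\<lambda>x. has_hamilton_cycle (\<lambda>i j. kpkvb_adj R (x i) (x j)) k)"
    unfolding has_hamilton_cycle_iff_PiE
  proof (intro pred_intros_logic pred_intros_finite)
    show "finite ({0..<k} \<rightarrow>\<^sub>E {0..<k})" by (intro finite_PiE) auto
    show "Measurable.pred ?P (\<lambda>x. kpkvb_adj R (x (\<sigma> i)) (x (\<sigma> ((i + 1) mod k))))"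
      if "\<sigma> \<in> {0..<k} \<rightarrow>\<^sub>E {0..<k}" "i \<in> {0..<k}" for \<sigma> i
      by (intro pred_kpkvb_adj comp PiE_mem[OF that(1)]) (use that(2) in auto)
  qed auto
  then show ?thesis by simp
qed

lemma root_tree_cells:
  assumes "depth_ok R (Suc d) (pi / 8)"
  shows "disjoint_cells (root_tree R (Suc d) j)" "cells (root_tree R (Suc d) j) \<subseteq> sets borel"
  using disjoint_cells_sector[OF assms rho_root(2)] cells_sector_sets
  unfolding root_tree_def borel_prod by blast+

text \<open>Union bound over the sectors: almost surely, failure forces some root cell to be too
  sparse, and then its term in the sum is at least 1.\<close>

lemma one_minus_ham_prob_k_le:
  assumes "0 < \<alpha>" "0 < R" "2 * rho (pi / 8) \<le> R" "depth_ok R (Suc d) (pi / 8)"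
  shows "1 - ham_prob_k \<alpha> R k \<le> (\<Sum>j<16. exp 1 * ((\<integral>x. majorant
    (\<lambda>A. exp (- real (num_points {0..<k} x A))) (root_tree R (Suc d) j)
      \<partial>PiM {0..<k} (\<lambda>_. point_dist \<alpha> R)) - 1))"
proof -
  let ?P = "PiM {0..<k} (\<lambda>_. point_dist \<alpha> R)"
  let ?maj = "\<lambda>x. majorant (\<lambda>A. exp (- real (num_points {0..<k} x A)))"
  let ?t = "root_tree R (Suc d)"
  interpret M: prob_space "point_dist \<alpha> R" by (rule prob_space_point_dist) (rule assms)+
  interpret P: prob_space ?P by (intro prob_space_PiM M.prob_space_axioms)
  define H where "H = {x \<in> space ?P. has_hamilton_cycle (\<lambda>i j. kpkvb_adj R (x i) (x j)) k}"
  have H: "H \<in> sets ?P" unfolding H_def by (rule hamilton_event_sets)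
  have int: "integrable ?P (\<lambda>x. ?maj x (?t j))" for j
    by (rule M.integrable_majorant) (use root_tree_cells[OF assms(4)] in auto)
  have maj_ge: "1 \<le> ?maj x t" for x t by (rule majorant_ge_1) simp
  have nn: "0 \<le> exp 1 * (?maj x t - 1)" for x t using maj_ge[of x t] by simp
  have "AE x in ?P. inj_on x {0..<k}"
    by (rule AE_PiM_inj_on) (auto simp: M.prob_space_axioms emeasure_point_dist_singleton)
  moreover have "AE x in ?P. \<forall>i\<in>{0..<k}. x i \<in> polar_disk R"
    by (intro AE_finite_allI AE_PiM_component M.prob_space_axioms AE_point_dist_disk) auto
  ultimately have "AE x in ?P. indicator (space ?P - H) x \<le> (\<Sum>j<16. exp 1 * (?maj x (?t j) - 1))"
    using AE_space
  proof eventually_elim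
    case (elim x)
    show ?case
    proof (cases "x \<in> H")
      case True
      then show ?thesis using nn by (auto intro!: sum_nonneg)
    next
      case False
      then have "\<not> has_hamilton_cycle (\<lambda>i j. kpkvb_adj R (x i) (x j)) k"
        using elim(3) by (simp add: H_def)
      then obtain j l A r where j: "j < 16" "?t j = Branch l A r" and
        "num_points {0..<k} x A \<le> excess (num_points {0..<k} x) l + excess (num_points {0..<k} x) r + 2"
        using has_hamilton_cycle_if_excess[OF assms(3,4) elim(1)] elim(2)
        by (meson atLeastLessThan_iff le0 not_le)
      from majorant_Branch_ge_if_excess[of "num_points {0..<k} x", OF this(3)]
      have "1 \<le> exp 1 * (?maj x (?t j) - 1)" unfolding j(2) .
      also have "\<dots> \<le> (\<Sum>j<16. exp 1 * (?maj x (?t j) - 1))"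
        using j(1) by (intro member_le_sum nn) auto
      finally show ?thesis by (rule order_trans[OF indicator_le_1])
    qed
  qed
  then have "(\<integral>x. indicator (space ?P - H) x \<partial>?P) \<le> (\<integral>x. (\<Sum>j<16. exp 1 * (?maj x (?t j) - 1)) \<partial>?P)"
    using H int by (intro integral_mono_AE) (auto simp: P.emeasure_eq_measure)
  also have "(\<integral>x. indicator (space ?P - H) x \<partial>?P) = 1 - P.prob H"
    using H by (simp add: P.prob_compl)
  also have "(\<integral>x. (\<Sum>j<16. exp 1 * (?maj x (?t j) - 1)) \<partial>?P) = (\<Sum>j<16. exp 1 * ((\<integral>x. ?maj x (?t j) \<partial>?P) - 1))"
    using int by (simp add: P.prob_space)
  finally show ?thesis by (simp add: ham_prob_k_def H_def)
qed

lemma poisson_weights_sums: "(\<lambda>k. exp (- s) * s ^ k / fact k) sums 1" for s :: real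
  using sums_mult[OF exp_converges[of s], of "exp (- s)"]
  by (simp add: divide_inverse mult_ac flip: exp_add)

lemma one_minus_ham_prob_Po_bounds:
  assumes "0 < \<alpha>" "0 < R" "2 * rho (pi / 8) \<le> R" "depth_ok R (Suc d) (pi / 8)" "R = kpkvb_R n \<nu>"
  shows "0 \<le> 1 - ham_prob_Po n \<alpha> \<nu>"
    and "1 - ham_prob_Po n \<alpha> \<nu> \<le> (\<Sum>j<16. exp 1 * (majorant
      (\<lambda>A. exp (- real n * (1 - exp (-1)) * measure (point_dist \<alpha> R) A)) (root_tree R (Suc d) j) - 1))"
proof -
  interpret M: prob_space "point_dist \<alpha> R" by (rule prob_space_point_dist) (rule assms)+
  define w where "w k = exp (- real n) * real n ^ k / fact k" for k
  define h where "h k = ham_prob_k \<alpha> R k" for k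
  have w: "w sums 1" unfolding w_def by (rule poisson_weights_sums)
  have w0: "0 \<le> w k" for k by (simp add: w_def)
  have h: "0 \<le> h k" "h k \<le> 1" for k
  proof -
    interpret P: prob_space "PiM {0..<k} (\<lambda>_. point_dist \<alpha> R)"
      by (intro prob_space_PiM M.prob_space_axioms)
    show "0 \<le> h k" "h k \<le> 1" by (simp_all add: h_def ham_prob_k_def)
  qed
  have "summable (\<lambda>k. w k * h k)"
    using w0 h mult_left_le[of "h _" "w _"]
    by (intro summable_comparison_test'[OF sums_summable[OF w]]) auto
  then have "(\<lambda>k. w k * h k) sums ham_prob_Po n \<alpha> \<nu>"
    unfolding ham_prob_Po_def w_def h_def assms(5) by (rule summable_sums)
  from sums_diff[OF w this] have fail: "(\<lambda>k. w k * (1 - h k)) sums (1 - ham_prob_Po n \<alpha> \<nu>)"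
    by (simp add: right_diff_distrib)
  show "0 \<le> 1 - ham_prob_Po n \<alpha> \<nu>"
    by (rule sums_le[OF _ sums_zero fail]) (use w0 h in auto)
  let ?I = "\<lambda>k j. \<integral>x. majorant (\<lambda>A. exp (- real (num_points {0..<k} x A))) (root_tree R (Suc d) j)
      \<partial>PiM {0..<k} (\<lambda>_. point_dist \<alpha> R)"
  have "(\<lambda>k. w k * ?I k j) sums majorant (\<lambda>A. exp (- real n * (1 - exp (-1)) * measure (point_dist \<alpha> R) A))
      (root_tree R (Suc d) j)" for j
    unfolding w_def by (rule M.poisson_integral_majorant) (use root_tree_cells[OF assms(4)] in auto)
  then have "(\<lambda>k. \<Sum>j<16. exp 1 * (w k * ?I k j - w k)) sums (\<Sum>j<16. exp 1 * (majorant
      (\<lambda>A. exp (- real n * (1 - exp (-1)) * measure (point_dist \<alpha> R) A)) (root_tree R (Suc d) j) - 1))"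
    by (intro sums_sum sums_mult sums_diff w)
  moreover have "w k * (1 - h k) \<le> (\<Sum>j<16. exp 1 * (w k * ?I k j - w k))" for k
    using mult_left_mono[OF one_minus_ham_prob_k_le[OF assms(1-4), of k] w0[of k]]
    unfolding h_def by (simp add: sum_distrib_left right_diff_distrib mult_ac)
  ultimately show "1 - ham_prob_Po n \<alpha> \<nu> \<le> (\<Sum>j<16. exp 1 * (majorant
      (\<lambda>A. exp (- real n * (1 - exp (-1)) * measure (point_dist \<alpha> R) A)) (root_tree R (Suc d) j) - 1))"
    by (intro sums_le[OF _ fail])
qed

section \<open>Mass of the cells\<close>

text \<open>The power of 2 is the ratio of exp (\<alpha> r) at the inner and outer radius of a layer
  of thickness 2 ln 2; 2 pi normalises the angle.\<close>

definition mass_const :: "real \<Rightarrow> real" where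
  "mass_const \<alpha> = (1 - 2 powr (- 2 * \<alpha>))\<^sup>2 / (2 * pi)"

lemma mass_const_pos: "0 < \<alpha> \<Longrightarrow> 0 < mass_const \<alpha>"
  using powr_less_mono[of "- 2 * \<alpha>" 0 2] by (simp add: mass_const_def)

text \<open>With q = exp (y - x), the difference equals (1 - q) (exp x - exp (- y)) / 2, and exp (-
  y) \<le> exp y = q exp x.\<close>

lemma cosh_diff_lower_bound:
  fixes x y :: real
  assumes "0 \<le> y" "y \<le> x"
  shows "(1 - exp (y - x))\<^sup>2 * exp x / 2 \<le> cosh x - cosh y"
proof -
  define q where "q = exp (y - x)"
  have q: "0 < q" "q \<le> 1" using assms by (simp_all add: q_def)
  have y: "exp y = q * exp x" by (simp add: q_def flip: exp_add)
  have "q * (exp x * exp (- y)) = exp y * exp (- y)" unfolding y by simp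
  then have "exp (- x) = q * exp (- y)"
    by (simp add: q_def flip: exp_add)
  have "exp (- y) \<le> exp y" using assms by simp
  then have "0 \<le> (1 - q) * (exp y - exp (- y))" using q by simp
  then have "(1 - q) * exp (- y) \<le> (1 - q) * (q * exp x)" unfolding y by (simp add: right_diff_distrib)
  moreover have "2 * (cosh x - cosh y) = (1 - q) * exp x - (1 - q) * exp (- y)"
    using \<open>exp (- x) = q * exp (- y)\<close> y unfolding cosh_field_def by (simp add: field_simps)
  moreover have "(1 - q)\<^sup>2 * exp x = (1 - q) * exp x - (1 - q) * (q * exp x)"
    by (simp add: power2_eq_square algebra_simps)
  ultimately have "(1 - q)\<^sup>2 * exp x \<le> 2 * (cosh x - cosh y)" by linarith
  then show ?thesis unfolding q_def[symmetric] by (simp add: pos_divide_le_eq mult.commute)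
qed

text \<open>The mass is of order w exp (\<alpha> (\<open>rho w\<close> - R)). In terms of y = w
  n/\<nu> the exponential is y powr (- 2 \<alpha>), and n w = \<nu> y supplies the remaining
  factor.\<close>

lemma measure_cell_ge:
  assumes "0 < \<alpha>" "0 < \<nu>" "0 < n" "R = kpkvb_R n \<nu>" "0 < R"
    and "0 \<le> lo" "lo \<le> rho (2 * w)" "exp (- R / 2) < w" "0 \<le> a" "a + w \<le> 2 * pi"
  shows "mass_const \<alpha> * \<nu> * (w * n / \<nu>) powr (1 - 2 * \<alpha>) \<le>
    real n * measure (point_dist \<alpha> R) (cell lo (rho w) a w)"
proof -
  have w: "0 < w" using assms(8) exp_gt_zero[of "- R / 2"] by linarith
  have le: "rho (2 * w) \<le> rho w" using w by (intro rho_mono) auto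
  have rhoR: "rho w < R" by (rule rho_less) (rule assms)
  define K where "K = cosh (\<alpha> * R) - 1"
  have "cosh (\<alpha> * R) > 1" using cosh_real_nonneg_less_iff[of 0 "\<alpha> * R"] assms by simp
  then have K: "0 < K" by (simp add: K_def)
  have "exp (- (\<alpha> * R)) \<le> 1" using assms by simp
  then have "exp (- (\<alpha> * R)) \<le> 2" by linarith
  then have K_le: "K \<le> exp (\<alpha> * R) / 2" by (simp add: K_def cosh_field_def field_simps)
  define y where "y = w * n / \<nu>"
  have y: "0 < y" using w assms by (simp add: y_def)
  have R: "R = 2 * ln (n / \<nu>)" using assms(4) by (simp add: kpkvb_R_def)
  have "ln y = ln w + ln (n / \<nu>)"
    using ln_mult_pos[OF w, of "n / \<nu>"] assms by (simp add: y_def)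
  then have expy: "exp (\<alpha> * rho w) / exp (\<alpha> * R) = y powr (- 2 * \<alpha>)"
    using y by (simp add: powr_def rho_def R algebra_simps flip: exp_diff)
  have "exp (\<alpha> * rho (2 * w) - \<alpha> * rho w) = 2 powr (- 2 * \<alpha>)"
    using w by (simp add: powr_def rho_def ln_mult_pos algebra_simps)
  moreover have "(1 - exp (\<alpha> * rho (2 * w) - \<alpha> * rho w))\<^sup>2 * exp (\<alpha> * rho w) / 2 \<le>
      cosh (\<alpha> * rho w) - cosh (\<alpha> * rho (2 * w))"
    by (rule cosh_diff_lower_bound) (use assms le in auto)
  moreover have "cosh (\<alpha> * lo) \<le> cosh (\<alpha> * rho (2 * w))"
    using assms by (intro cosh_real_nonneg_le_iff[THEN iffD2]) auto
  ultimately have num: "(1 - 2 powr (- 2 * \<alpha>))\<^sup>2 * exp (\<alpha> * rho w) / 2 \<le> cosh (\<alpha> * rho w) - cosh (\<alpha> * lo)"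
    by simp
  have "0 \<le> (1 - 2 powr (- 2 * \<alpha>))\<^sup>2 * exp (\<alpha> * rho w) / 2" by simp
  from this num have nonneg: "0 \<le> cosh (\<alpha> * rho w) - cosh (\<alpha> * lo)" by (rule order_trans)
  have "mass_const \<alpha> * y powr (- 2 * \<alpha>) =
      ((1 - 2 powr (- 2 * \<alpha>))\<^sup>2 * exp (\<alpha> * rho w) / 2) / (2 * pi * (exp (\<alpha> * R) / 2))"
    unfolding mass_const_def expy[symmetric] by simp
  also have "\<dots> \<le> (cosh (\<alpha> * rho w) - cosh (\<alpha> * lo)) / (2 * pi * K)"
    using K K_le num nonneg by (intro frac_le mult_left_mono) auto
  finally have "w * n * (mass_const \<alpha> * y powr (- 2 * \<alpha>)) \<le>
      w * n * ((cosh (\<alpha> * rho w) - cosh (\<alpha> * lo)) / (2 * pi * K))"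
    using w by (intro mult_left_mono) auto
  moreover have "measure (point_dist \<alpha> R) (cell lo (rho w) a w) =
      w * (cosh (\<alpha> * rho w) - cosh (\<alpha> * lo)) / (2 * pi * K)"
    unfolding measure_def using assms w K le rhoR nonneg
    by (subst emeasure_point_dist_cell) (auto simp: K_def intro!: enn2real_ennreal divide_nonneg_nonneg)
  moreover have "w * n = \<nu> * y" using assms by (simp add: y_def)
  then have "w * n * (mass_const \<alpha> * y powr (- 2 * \<alpha>)) = mass_const \<alpha> * \<nu> * y powr (1 - 2 * \<alpha>)"
    using y by (simp add: powr_diff powr_minus field_simps)
  moreover have "real n * (w * (cosh (\<alpha> * rho w) - cosh (\<alpha> * lo)) / (2 * pi * K)) =
      w * n * ((cosh (\<alpha> * rho w) - cosh (\<alpha> * lo)) / (2 * pi * K))"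
    by simp
  ultimately show ?thesis unfolding y_def[symmetric] by (simp only:)
qed

lemma one_minus_ham_prob_Po_le:
  assumes "0 < \<alpha>" "\<alpha> < 1/2" "6 / mass_const \<alpha> < \<nu>" "0 < n" "\<nu> / n < pi / 8"
    and "2 * rho (pi / 8) \<le> kpkvb_R n \<nu>"
  shows "\<bar>1 - ham_prob_Po n \<alpha> \<nu>\<bar> \<le>
    64 * exp 2 * exp (- (mass_const \<alpha> * \<nu> * (pi / 8 * n / \<nu>) powr (1 - 2 * \<alpha>) / 2))"
proof -
  define R where "R = kpkvb_R n \<nu>"
  define c where "c = mass_const \<alpha>"
  have c: "0 < c" using mass_const_pos[OF assms(1)] by (simp add: c_def)
  have \<nu>: "0 < \<nu>" using assms(3) c unfolding c_def[symmetric] by (meson divide_pos_pos less_trans zero_less_numeral)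
  have c\<nu>: "6 < c * \<nu>" using assms(3) c unfolding c_def[symmetric] by (simp add: field_simps)
  have expR: "exp (- R / 2) = \<nu> / n"
    using \<nu> assms(4) by (simp add: R_def kpkvb_R_def exp_minus)
  have "pi / 8 < 1" using pi_less_4 by simp
  then have "exp (- R / 2) < 1" using assms(5) unfolding expR by linarith
  then have R: "0 < R" by simp
  obtain d where d: "depth_ok R (Suc d) (pi / 8)"
    using depth_ok_exists[of R "pi / 8"] assms(5) unfolding expR by blast
  define g where "g A = exp (- real n * (1 - exp (-1)) * measure (point_dist \<alpha> R) A)" for A
  have e: "2 \<le> exp (1::real)" using exp_ge_add_one_self[of 1] by simp
  then have half: "1 / 2 \<le> 1 - exp (-1::real)" by (simp add: exp_minus field_simps)
  have g_le: "g (cell lo (rho w) a w) \<le> exp (- (c * \<nu> * (w * n / \<nu>) powr (1 - 2 * \<alpha>) / 2))"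
    if "0 \<le> lo" "lo \<le> rho (2 * w)" "exp (- R / 2) < w" "0 \<le> a" "a + w \<le> 2 * pi" for lo a w
  proof -
    have "c * \<nu> * (w * n / \<nu>) powr (1 - 2 * \<alpha>) * (1 / 2) \<le>
        real n * measure (point_dist \<alpha> R) (cell lo (rho w) a w) * (1 - exp (-1))"
      unfolding c_def
      by (rule mult_mono[OF measure_cell_ge[OF assms(1) \<nu> assms(4) R_def R that] half]) auto
    then show ?thesis by (simp add: g_def mult_ac)
  qed
  have small: "4 * exp 1 * g A \<le> 1" if j: "j < 16" and A: "A \<in> cells (root_tree R (Suc d) j)" for j A
    using d rho_root(1) order_refl A[unfolded root_tree_def]
  proof (rule cells_sector)
    fix lo a w
    assume *: "A = cell lo (rho w) a w" "0 \<le> lo" "lo \<le> rho (2 * w)" "exp (- R / 2) < w"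
      "real j * pi / 8 \<le> a" "a + w \<le> real j * pi / 8 + pi / 8"
    \<comment> \<open>Uses \<open>exp (- R / 2)\<close> = \<nu>/n: no linking cell is narrower than
      this.\<close>
    have "1 \<le> w * n / \<nu>" using *(4) \<nu> assms(4) unfolding expR by (simp add: field_simps)
    then have "1 \<le> (w * n / \<nu>) powr (1 - 2 * \<alpha>)" using assms(2) by (intro ge_one_powr_ge_zero) auto
    then have "6 \<le> c * \<nu> * (w * n / \<nu>) powr (1 - 2 * \<alpha>)"
      using c\<nu> mult_mono[of 6 "c * \<nu>" 1] by simp
    moreover have "0 \<le> a" using *(5) order_trans[of 0 "real j * pi / 8" a] by simp
    moreover have "a + w \<le> 2 * pi" using *(6) sector_angle_le[OF j] by linarith
    ultimately have "c * \<nu> * (w * n / \<nu>) powr (1 - 2 * \<alpha>) / 2 \<ge> 3" "0 \<le> a" "a + w \<le> 2 * pi"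
      by linarith+
    \<comment> \<open>Origin of the 6 in the threshold for \<nu>: half of it, as 1 - 1/e \<ge> 1/2,
      is the exponent 3, and 4 exp 1 exp (- 3) = 4 exp (- 2) \<le> 1.\<close>
    then have "g A \<le> exp (- 3)"
      using g_le[OF *(2-4), of a] order_trans unfolding *(1) by fastforce
    moreover have "4 * exp 1 * exp (- 3) \<le> (1::real)"
    proof -
      have "4 \<le> exp (1::real) * exp 1" using mult_mono[OF e e] by simp
      also have "\<dots> = exp 2" by (simp flip: exp_add)
      finally have "4 * exp (- 2) \<le> exp 2 * exp (- 2 :: real)" by (rule mult_right_mono) simp
      then have "4 * exp (- 2) \<le> (1::real)" by (simp flip: exp_add)
      moreover have "exp 1 * exp (- 3) = (exp (- 2)::real)" by (simp flip: exp_add)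
      ultimately show ?thesis by (simp only: mult.assoc)
    qed
    ultimately show ?thesis
      by (meson mult_left_mono order_trans exp_ge_zero mult_nonneg_nonneg zero_le_numeral)
  qed
  have "majorant g (root_tree R (Suc d) j) - 1 \<le>
      4 * exp 1 * exp (- (c * \<nu> * (pi / 8 * n / \<nu>) powr (1 - 2 * \<alpha>) / 2))" if j: "j < 16" for j
  proof -
    obtain l r where lr: "root_tree R (Suc d) j = Branch l (root_cell j) r"
      by (simp add: root_tree_def root_cell_def)
    have "majorant g (root_tree R (Suc d) j) - 1 \<le> 4 * exp 1 * g (root_cell j)"
      unfolding lr
    proof (rule majorant_Branch_le)
      show "0 \<le> g A" for A by (simp add: g_def)
    qed (rule small[OF j, unfolded lr])
    also have "g (root_cell j) \<le> exp (- (c * \<nu> * (pi / 8 * n / \<nu>) powr (1 - 2 * \<alpha>) / 2))"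
      unfolding root_cell_def
      by (rule g_le) (use rho_root(1) depth_ok_Suc(2)[OF d] sector_angle_le[OF j] in auto)
    finally show ?thesis by simp
  qed
  then have "(\<Sum>j<16. exp 1 * (majorant g (root_tree R (Suc d) j) - 1)) \<le>
      (\<Sum>j<16::nat. exp 1 * (4 * exp 1 * exp (- (c * \<nu> * (pi / 8 * n / \<nu>) powr (1 - 2 * \<alpha>) / 2))))"
    by (intro sum_mono mult_left_mono) auto
  \<comment> \<open>64 is 16 sectors times 4; one factor \<open>exp 1\<close> comes from the Markov
    step, the other from \<open>majorant\<close>.\<close>
  also have "\<dots> = 64 * exp 2 * exp (- (c * \<nu> * (pi / 8 * n / \<nu>) powr (1 - 2 * \<alpha>) / 2))"
    by (simp flip: exp_add)
  finally show ?thesis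
    using one_minus_ham_prob_Po_bounds[OF assms(1) R assms(6)[folded R_def] d R_def]
    unfolding g_def c_def by linarith
qed

theorem mainTheorem5:
  fixes \<alpha> :: real
  assumes "0 < \<alpha>" and "\<alpha> < 1/2"
  shows "\<exists>\<nu>1>0. \<forall>\<nu>>\<nu>1.
           (\<lambda>n::nat. 1 - ham_prob_Po n \<alpha> \<nu>) \<in> o(\<lambda>n. real n powr (-1/2))"
proof (intro exI[of _ "6 / mass_const \<alpha>"] conjI allI impI)
  show "0 < 6 / mass_const \<alpha>" using mass_const_pos[OF assms(1)] by simp
  fix \<nu> assume \<nu>: "6 / mass_const \<alpha> < \<nu>"
  then have \<nu>0: "0 < \<nu>" using mass_const_pos[OF assms(1)] by (meson divide_pos_pos less_trans zero_less_numeral)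
  define b where "b = 1 - 2 * \<alpha>"
  define C where "C = mass_const \<alpha> * \<nu> * (pi / 8 / \<nu>) powr b / 2"
  have b: "0 < b" using assms by (simp add: b_def)
  have C: "0 < C" using mass_const_pos[OF assms(1)] \<nu>0 by (simp add: C_def)
  have "eventually (\<lambda>n::nat. \<nu> / n < pi / 8) at_top" using \<nu>0 by real_asymp
  moreover have "eventually (\<lambda>n::nat. 2 * rho (pi / 8) \<le> kpkvb_R n \<nu>) at_top"
    unfolding kpkvb_R_def using \<nu>0 by real_asymp
  ultimately have "eventually (\<lambda>n::nat. norm (1 - ham_prob_Po n \<alpha> \<nu>) \<le>
      64 * exp 2 * norm (exp (- (C * real n powr b)))) at_top"
    using eventually_gt_at_top[of 0]
  proof eventually_elim
    case (elim n)
    have "(pi / 8 * n / \<nu>) powr b = (pi / 8 / \<nu>) powr b * real n powr b"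
      using \<nu>0 powr_mult[of "pi / 8 / \<nu>" "real n" b] by simp
    then show ?case
      using one_minus_ham_prob_Po_le[OF assms \<nu> elim(3,1,2)]
      by (simp add: C_def b_def mult_ac)
  qed
  then have "(\<lambda>n. 1 - ham_prob_Po n \<alpha> \<nu>) \<in> O(\<lambda>n. exp (- (C * real n powr b)))"
    by (rule bigoI)
  \<comment> \<open>A stretched exponential with b > 0 beats every power of n.\<close>
  also have "(\<lambda>n. exp (- (C * real n powr b))) \<in> o(\<lambda>n. real n powr (-1/2))"
    using b C by real_asymp
  finally show "(\<lambda>n::nat. 1 - ham_prob_Po n \<alpha> \<nu>) \<in> o(\<lambda>n. real n powr (-1/2))" .
qed

end
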